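(* Let $k\geq2$ be an integer and $\ell\in\{3,5\}$. Then, as $n\to\infty$, \[\mathrm{ex}(n,\boldsymbol{\mathcal{D}}(\mathcal{S}^kC_{2\ell}))=\Theta(n^{k-1+1/\ell}),\] where the implied constants may depend on $k$ and $\ell$ but not on $n$.
   Context: For an integer $k\geq2$ and a graph $F$, the $k$-uniform suspension $\mathcal{S}^kF$ is the $k$-uniform hypergraph with vertex set $S\cup V(F)$ and edge set $\{S\cup e:\,e\in E(F)\}$, where $S$ is a set of size $k-2$ disjoint from $V(F)$. $C_{2\ell}$ is the cycle of length $2\ell$. A $(k-1)$-dimensional (abstract) simplicial complex $\boldsymbol{F}=(V(\boldsymbol{F}),E(\boldsymbol{F}))$ is a non-uniform hypergraph without isolated vertices (every vertex lies in some edge), where $E(\boldsymbol{F})$ is closed under taking subsets (the empty set counts as an edge) and has maximum edge size $k$. A simplicial complex is $\boldsymbol{F}$-free if it contains no (not necessarily induced) subcomplex isomorphic to $\boldsymbol{F}$. $\mathrm{ex}(n,\boldsymbol{F})$ denotes the maximum number of edges in an $n$-vertex $\boldsymbol{F}$-free simplicial complex (of arbitrary dimension). For a $k$-uniform hypergraph $H$ without isolated vertices, $\boldsymbol{\mathcal{D}}(H)$ denotes the $(k-1)$-dimensional simplicial complex obtained by taking the downward closure of $E(H)$, i.e. its edges are all subsets of edges of $H$. *)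

theory Defs
  imports Complex_Main "HOL-Library.Landau_Symbols"
begin

text \<open>
  A hypergraph, uniform or not, is a pair of a vertex set and an edge set;
  a graph is a hypergraph all of whose edges have two elements.
\<close>

type_synonym 'a hypergraph = "'a set \<times> 'a set set"

abbreviation verts :: "'a hypergraph \<Rightarrow> 'a set" where
  "verts \<equiv> fst"

abbreviation edges :: "'a hypergraph \<Rightarrow> 'a set set" where
  "edges \<equiv> snd"

text \<open>For \<open>m \<ge> 3\<close> this is the cycle of length \<open>m\<close>.\<close>

definition cycle_graph :: "nat \<Rightarrow> nat hypergraph" where
  "cycle_graph m = ({..<m}, {{i, Suc i mod m} | i. i < m})"

text \<open>
  The \<open>k - 2\<close> new vertices (for \<open>k \<ge> 2\<close>) are made disjoint from the vertices of \<open>F\<close>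
  by passing to the sum type.
\<close>

definition suspension :: "nat \<Rightarrow> 'a hypergraph \<Rightarrow> (nat + 'a) hypergraph" where
  "suspension k F =
     (let S = Inl ` {..<k - 2}
      in (S \<union> Inr ` verts F, {S \<union> Inr ` e | e. e \<in> edges F}))"

definition down_closure :: "'a hypergraph \<Rightarrow> 'a hypergraph" where
  "down_closure H = (verts H, {a. \<exists>e\<in>edges H. a \<subseteq> e})"

definition abstract_simplicial_complex :: "'a hypergraph \<Rightarrow> bool" where
  "abstract_simplicial_complex F \<longleftrightarrow>
     finite (verts F) \<and>
     edges F \<subseteq> Pow (verts F) \<and>
     (\<forall>v\<in>verts F. \<exists>e\<in>edges F. v \<in> e) \<and>
     {} \<in> edges F \<and>
     (\<forall>e\<in>edges F. \<forall>a. a \<subseteq> e \<longrightarrow> a \<in> edges F)"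

definition subcomplex :: "'a hypergraph \<Rightarrow> 'a hypergraph \<Rightarrow> bool" where
  "subcomplex G F \<longleftrightarrow>
     abstract_simplicial_complex G \<and> verts G \<subseteq> verts F \<and> edges G \<subseteq> edges F"

definition hypergraph_isomorphic :: "'a hypergraph \<Rightarrow> 'b hypergraph \<Rightarrow> bool" where
  "hypergraph_isomorphic G H \<longleftrightarrow>
     (\<exists>f. bij_betw f (verts G) (verts H) \<and> (\<lambda>e. f ` e) ` edges G = edges H)"

definition complex_free :: "'b hypergraph \<Rightarrow> 'a hypergraph \<Rightarrow> bool" where
  "complex_free F K \<longleftrightarrow> (\<nexists>G. subcomplex G K \<and> hypergraph_isomorphic G F)"

text \<open>
  Up to isomorphism every finite complex has its vertices in \<open>nat\<close>. The edge counts are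
  at most \<open>2 ^ n\<close>, so the maximum is taken over a finite set, and this set is nonempty as
  soon as \<open>F\<close> has an edge with at least two vertices (the complex whose only edges are the
  empty set and the singletons is then \<open>F\<close>-free). The empty edge is counted.
\<close>

definition ex_complex :: "nat \<Rightarrow> 'b hypergraph \<Rightarrow> nat" where
  "ex_complex n F =
     Max {card (edges K) | K :: nat hypergraph.
            abstract_simplicial_complex K \<and> card (verts K) = n \<and> complex_free F K}"

end

theory Submission
  imports Defs "HOL-Library.Z2" "HOL-Algebra.Algebraic_Closure_Type"
begin

text \<open>
  Upper bound. Every face of the complex consists of a set \<open>S\<close> of at most \<open>k - 2\<close> vertices and a face
  of the link of \<open>S\<close>; if \<open>S\<close> has \<open>k - 2\<close> elements, the graph of that link contains no \<open>C\<^bsub>2l\<^esub>\<close>. By the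
  Bondy--Simonovits theorem it has \<open>O(n\<^bsup>1+1/l\<^esup>)\<close> edges, and it has at most \<open>O(d(v))\<close> cliques through a
  vertex \<open>v\<close>, because the graph induced on the neighbourhood of \<open>v\<close> contains no long path.

  Lower bound. Let \<open>G\<close> be a finite group and \<open>S \<subseteq> G\<close>. Join \<open>x\<^sub>1, \<dots>, x\<^sub>k\<close>, one from each of \<open>k\<close> copies of
  \<open>G\<close>, if \<open>x\<^sub>1 \<cdots> x\<^sub>k \<in> S\<close>. A \<open>C\<^bsub>2l\<^esub>\<close> in a link gives, after telescoping and conjugation,
  \<open>s\<^sub>0\<inverse> s\<^sub>1 s\<^sub>2\<inverse> s\<^sub>3 \<cdots> s\<^bsub>2l-1\<^esub> = 1\<close> with \<open>s\<^sub>i \<in> S\<close> and cyclically consecutive \<open>s\<^sub>i\<close> distinct. Let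
  \<open>m(x) = (1, x, \<dots>, x\<^bsup>l-1\<^esup>)\<close> be the moment curve over \<open>F\<^sub>q\<close> and \<open>A\<^sub>t\<close> the linear map with
  \<open>A\<^sub>t m(x) = m(x + t)\<close>. Take \<open>G = F\<^sub>q\<^sup>l\<close> with \<open>v w = v + A\<^bsub>v\<^sub>0\<^esub> w\<close>, and \<open>S\<close> the multiples of the first
  unit vector. The product becomes \<open>\<Sum>\<^sub>j \<tau>\<^sub>j m(y\<^sub>j)\<close> with \<open>\<tau>\<^sub>j \<noteq> 0\<close> and cyclically consecutive \<open>y\<^sub>j\<close>
  distinct. By Vandermonde it vanishes only if every value among \<open>y\<^sub>0, \<dots>, y\<^bsub>l-1\<^esub>\<close> is attained twice,
  which is impossible for \<open>l = 3\<close> and \<open>l = 5\<close>.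
\<close>

section \<open>Paths in graphs of large minimum degree\<close>

definition contains_cycle :: "('a \<Rightarrow> 'a \<Rightarrow> bool) \<Rightarrow> nat \<Rightarrow> 'a set \<Rightarrow> bool" where
  "contains_cycle E m V \<longleftrightarrow>
     (\<exists>xs. length xs = m \<and> distinct xs \<and> set xs \<subseteq> V \<and> xs \<noteq> [] \<and> successively E xs \<and> E (last xs) (hd xs))"

text \<open>Greedy extension: the current endpoint has more than \<open>D\<close> neighbours in
  \<open>W\<close>, and by the length condition the path built so far and the forbidden set
  \<open>Z\<close> cover at most \<open>D\<close> of them.\<close>

lemma extend_path:
  assumes "\<And>w. w \<in> W \<Longrightarrow> D < card {u\<in>W. R w u}"
    and "finite Z" "xs \<noteq> []" "distinct xs" "set xs \<subseteq> W" "successively R xs"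
    and "length xs + n + card Z \<le> D + 1"
  shows "\<exists>ys. length ys = n \<and> distinct (xs @ ys) \<and> set ys \<subseteq> W - Z \<and> successively R (xs @ ys)"
  using assms(7)
proof (induction n)
  case 0
  then show ?case using assms by (intro exI[of _ "[]"]) auto
next
  case (Suc n)
  then obtain ys where ys: "length ys = n" "distinct (xs @ ys)" "set ys \<subseteq> W - Z" "successively R (xs @ ys)"
    by auto
  define w where "w = last (xs @ ys)"
  have w: "w \<in> W" using last_in_set[of "xs @ ys"] assms(3,5) ys(3) unfolding w_def by auto
  have "card (set (xs @ ys) \<union> Z) \<le> card (set (xs @ ys)) + card Z" by (rule card_Un_le)
  also have "\<dots> \<le> length xs + n + card Z" using card_length[of "xs @ ys"] ys(1) by simp
  also have "\<dots> \<le> D" using Suc.prems by simp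
  also have "\<dots> < card {u\<in>W. R w u}" using assms(1) w by blast
  finally have "\<not> {u\<in>W. R w u} \<subseteq> set (xs @ ys) \<union> Z"
    using card_mono[of "set (xs @ ys) \<union> Z"] assms(2) by (meson List.finite_set finite_Un leD)
  then obtain u where u: "u \<in> W" "R w u" "u \<notin> set (xs @ ys)" "u \<notin> Z" by blast
  show ?case
    using ys u w_def assms(3) 
    by (intro exI[of _ "ys @ [u]"]) (auto simp: successively_append_iff successively_Cons hd_append last_append)
qed

text \<open>
  Otherwise vertices at distance \<open>2 r\<close> along a path share their colour. Then a path of length \<open>2 t\<close>
  (\<open>t < r\<close>) that starts at \<open>b\<close> and avoids \<open>a, y\<close> ends in the colour of \<open>a\<close>: for \<open>t = r - 1\<close> prepend
  \<open>a, y\<close>; to pass from \<open>t + 1\<close> to \<open>t\<close>, extend the path by \<open>2 r\<close> vertices and compare its old endpoint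
  with an unused neighbour of the first new vertex. For \<open>t = 0\<close> this contradicts \<open>col a \<noteq> col b\<close>.
\<close>

lemma bicoloured_path:
  assumes deg: "\<And>w. w \<in> W \<Longrightarrow> 4 * r + 2 < card {u\<in>W. R w u}"
    and sym: "\<And>u v. R u v \<Longrightarrow> R v u"
    and bip: "\<And>u v. R u v \<Longrightarrow> P u \<longleftrightarrow> \<not> P v"
    and ayb: "a \<in> W" "y \<in> W" "b \<in> W" "R a y" "R y b" "P a" "col a \<noteq> (col b::bool)"
    and r: "r \<ge> 1"
  shows "\<exists>xs. length xs = 2 * r + 1 \<and> distinct xs \<and> set xs \<subseteq> W \<and> successively R xs \<and>
              P (hd xs) \<and> col (hd xs) \<noteq> col (last xs)"
proof (rule ccontr)
  assume neg: "\<not> ?thesis"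
  have N: "col (hd xs) = col (last xs)"
    if "length xs = 2 * r + 1" "distinct xs" "set xs \<subseteq> W" "successively R xs" "P (hd xs)" for xs
    using neg that by blast
  have Pb: "P b" using bip ayb by blast
  have ne: "a \<noteq> y" "y \<noteq> b" "a \<noteq> b" using bip ayb by auto
  have claim: "\<forall>xs. length xs = 2 * (r - 1 - j) + 1 \<and> distinct xs \<and> set xs \<subseteq> W - {a, y} \<and>
      successively R xs \<and> hd xs = b \<and> P (last xs) \<longrightarrow> col (last xs) = col a" if "j \<le> r - 1" for j
    using that
  proof (induction j)
    case 0
    show ?case
    proof (intro allI impI, elim conjE)
      fix xs assume xs: "length xs = 2 * (r - 1 - 0) + 1" "distinct xs" "set xs \<subseteq> W - {a, y}"
        "successively R xs" "hd xs = b"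
      have "xs \<noteq> []" using xs(1) by auto
      then have "col (hd (a # y # xs)) = col (last (a # y # xs))"
        using xs ayb r ne by (intro N) (auto simp: successively_Cons)
      then show "col (last xs) = col a" using \<open>xs \<noteq> []\<close> by simp
    qed
  next
    case (Suc j)
    show ?case
    proof (intro allI impI, elim conjE)
      fix xs assume xs: "length xs = 2 * (r - 1 - Suc j) + 1" "distinct xs" "set xs \<subseteq> W - {a, y}"
        "successively R xs" "hd xs = b" "P (last xs)"
      have xne: "xs \<noteq> []" using xs(1) by auto
      have "card {a, y} = 2" using ne by simp
      then obtain ys where ys: "length ys = 2 * r" "distinct (xs @ ys)" "set ys \<subseteq> W - {a, y}"
          "successively R (xs @ ys)"
        using extend_path[of W "4 * r + 2" R "{a, y}" xs "2 * r"] deg xs xne Suc.prems by auto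
      have yne: "ys \<noteq> []" using ys(1) r by auto
      define y1 where "y1 = hd ys"
      have y1: "y1 \<in> W" "y1 \<in> set ys" using subsetD[OF ys(3) hd_in_set[OF yne]] yne by (auto simp: y1_def)
      have lx: "R (last xs) y1" using ys(4) xne yne by (auto simp: successively_append_iff y1_def)
      have lys: "last xs \<notin> set ys" using ys(2) last_in_set[OF xne] unfolding distinct_append by blast
      have "\<not> P y1" using bip lx xs(6) by blast
      \<comment> \<open>The degree bound \<open>4 * r + 2\<close> is chosen for this count: fewer
        than \<open>2 * r\<close> old path vertices, \<open>2 * r\<close> new ones, and
        \<open>a\<close>, \<open>y\<close>.\<close>
      have "card (set (xs @ ys) \<union> {a, y}) \<le> card (set (xs @ ys)) + 2"
        using card_Un_le[of "set (xs @ ys)" "{a, y}"] ne by simp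
      also have "\<dots> \<le> length xs + length ys + 2" using card_length[of "xs @ ys"] by simp
      also have "\<dots> \<le> 4 * r + 2" using xs(1) ys(1) Suc.prems by simp
      also have "\<dots> < card {u\<in>W. R y1 u}" using deg y1 by blast
      finally have "\<not> {u\<in>W. R y1 u} \<subseteq> set (xs @ ys) \<union> {a, y}"
        using card_mono[of "set (xs @ ys) \<union> {a, y}"] by (meson List.finite_set finite.emptyI finite_insert finite_Un leD)
      then obtain x' where x': "x' \<in> W" "R y1 x'" "x' \<notin> set (xs @ ys)" "x' \<notin> {a, y}" by blast
      have Px': "P x'" using bip x' \<open>\<not> P y1\<close> by blast
      have "length (xs @ [y1, x']) = 2 * (r - 1 - j) + 1" using xs(1) Suc.prems by simp
      moreover have "distinct (xs @ [y1, x'])" using xs x' y1 ys(2) by auto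
      moreover have "successively R (xs @ [y1, x'])" using xs(4) lx x'
        by (auto simp: successively_append_iff)
      moreover have "set (xs @ [y1, x']) \<subseteq> W - {a, y}" using xs x' ys(3) y1 by auto
      moreover have "hd (xs @ [y1, x']) = b" using xs xne by simp
      ultimately have c1: "col x' = col a" using Suc.IH Suc.prems Px' by (auto dest!: spec[of _ "xs @ [y1, x']"])
      have "col (hd (x' # ys)) = col (last (x' # ys))"
        using x' ys yne Px' sym by (intro N) (auto simp: successively_append_iff successively_Cons y1_def)
      moreover have "col (hd (last xs # ys)) = col (last (last xs # ys))"
        using xs ys yne xne subsetD[OF xs(3) last_in_set[OF xne]] lys
        by (intro N) (auto simp: successively_append_iff successively_Cons)
      ultimately show "col (last xs) = col a" using c1 yne by simp
    qed
  qed
  have "col b = col a"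
    using claim[of "r - 1"] ayb ne Pb by (auto dest!: spec[of _ "[b]"])
  then show False using ayb by simp
qed

text \<open>Serves for \<open>f\<close> the \<open>(m + 1)\<close>-st ancestor and \<open>P\<close>
  the level \<open>i\<close>: a value that agrees two steps apart agrees at the ends of a path of
  even length.\<close>

lemma path_invariant_on_even_vertices:
  assumes "\<And>x y z. R x y \<Longrightarrow> R y z \<Longrightarrow> x \<in> W \<Longrightarrow> y \<in> W \<Longrightarrow> z \<in> W \<Longrightarrow> P x \<Longrightarrow> f x = f z \<and> P z"
    and "length xs = 2 * r + 1" "set xs \<subseteq> W" "successively R xs" "P (hd xs)"
  shows "f (hd xs) = f (last xs) \<and> P (last xs)"
  using assms(2-)
proof (induction r arbitrary: xs)
  case 0
  then obtain x where "xs = [x]" by (cases xs) auto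
  then show ?case using 0 by simp
next
  case (Suc r)
  then obtain x y zs where xs: "xs = x # y # zs" "length zs = 2 * r + 1"
    by (cases xs; cases "tl xs") auto
  then have "zs \<noteq> []" by auto
  have "hd zs \<in> W" using hd_in_set[OF \<open>zs \<noteq> []\<close>] xs Suc.prems by auto
  then have "f x = f (hd zs) \<and> P (hd zs)" using xs Suc.prems assms(1)[of x y "hd zs"] \<open>zs \<noteq> []\<close>
    by (simp add: successively_Cons)
  moreover have "f (hd zs) = f (last zs) \<and> P (last zs)"
    using Suc.prems xs \<open>zs \<noteq> []\<close> calculation by (intro Suc.IH) (auto simp: successively_Cons)
  ultimately show ?case using xs \<open>zs \<noteq> []\<close> by simp
qed

text \<open>
  Choose \<open>m\<close> maximal such that two vertices of level \<open>i\<close> with a common neighbour in \<open>W\<close> have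
  distinct \<open>m\<close>-th ancestors. Colouring by the \<open>m\<close>-th ancestor yields a path of length \<open>2 (l - m - 1)\<close>
  whose ends have distinct \<open>m\<close>-th ancestors but, by maximality, the same \<open>(m + 1)\<close>-st one; the two
  tree paths to that ancestor close the cycle.
\<close>

lemma tree_cycle:
  fixes dep :: "'a \<Rightarrow> nat"
  assumes symE: "\<And>u v. E u v \<Longrightarrow> E v u"
    and root: "\<And>w. w \<in> V \<Longrightarrow> dep w = 0 \<Longrightarrow> w = v0"
    and par: "\<And>w. w \<in> V \<Longrightarrow> 0 < dep w \<Longrightarrow> p w \<in> V \<and> E (p w) w \<and> dep (p w) = dep w - 1"
    and W: "W \<subseteq> V" "W \<noteq> {}"
    and symR: "\<And>u v. R u v \<Longrightarrow> R v u"
    and RE: "\<And>u v. R u v \<Longrightarrow> E u v"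
    and lev: "\<And>u v. R u v \<Longrightarrow> dep u = i \<and> dep v = Suc i \<or> dep u = Suc i \<and> dep v = i"
    and deg: "\<And>w. w \<in> W \<Longrightarrow> 4 * l < card {u\<in>W. R w u}"
    and il: "i < l"
  shows "contains_cycle E (2 * l) V"
proof -
  define anc where "anc = (\<lambda>m. p ^^ m)"
  have anc: "anc m x \<in> V \<and> dep (anc m x) = dep x - m" if "x \<in> V" "m \<le> dep x" for m x
    using that
  proof (induction m)
    case 0 then show ?case by (simp add: anc_def)
  next
    case (Suc m)
    then have "anc m x \<in> V" "dep (anc m x) = dep x - m" by auto
    then show ?case using par[of "anc m x"] Suc.prems by (simp add: anc_def)
  qed
  have ancS: "E (anc (Suc m) x) (anc m x)" if "x \<in> V" "m < dep x" for m x
    using par[of "anc m x"] anc[of x m] that by (simp add: anc_def)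
  have anc_mono: "anc m' x = anc m' y" if "anc m x = anc m y" "m \<le> m'" for m m' x y
  proof -
    have "anc m' z = anc (m' - m) (anc m z)" for z
      using that by (simp add: anc_def flip: funpow_add[unfolded o_def, THEN fun_cong])
    then show ?thesis using that by simp
  qed
  define M where "M = {m. \<exists>a\<in>W. \<exists>y\<in>W. \<exists>b\<in>W. R a y \<and> R y b \<and> dep a = i \<and> anc m a \<noteq> anc m b}"
  have ch: "dep b = i" if "R a y" "R y b" "dep a = i" for a y b
    using lev[OF that(1)] lev[OF that(2)] that by auto
  \<comment> \<open>At level \<open>i\<close> the \<open>i\<close>-th ancestor of every vertex is
    the root, so \<open>M\<close> is bounded and has a maximum.\<close>
  have M_less: "m < i" if "m \<in> M" for m
  proof (rule ccontr)
    assume "\<not> m < i"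
    from that obtain a y b where ab: "a \<in> W" "b \<in> W" "R a y" "R y b" "dep a = i" "anc m a \<noteq> anc m b"
      by (auto simp: M_def)
    have "anc i x = v0" if "x \<in> {a, b}" for x
      using anc[of x i] root[of "anc i x"] ab W ch[OF ab(3-5)] that by auto
    then have "anc i a = anc i b" by simp
    then show False using anc_mono ab \<open>\<not> m < i\<close> by (metis not_less)
  qed
  have nb: "\<exists>u\<in>W. R w u \<and> u \<noteq> x" if "w \<in> W" for w x
  proof (rule ccontr)
    assume "\<not> ?thesis"
    then have "{u\<in>W. R w u} \<subseteq> {x}" by blast
    then have "card {u\<in>W. R w u} \<le> 1" using card_mono[of "{x}"] by fastforce
    then show False using deg[OF that] il by simp
  qed
  have "0 \<in> M"
  proof -
    obtain w where "w \<in> W" using W by blast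
    then obtain u where u: "u \<in> W" "R w u" using nb by blast
    obtain a where a: "a \<in> W" "dep a = i" using lev[OF u(2)] u \<open>w \<in> W\<close> by blast
    obtain y where y: "y \<in> W" "R a y" using nb a by blast
    obtain b where b: "b \<in> W" "R y b" "b \<noteq> a" using nb y by blast
    then show ?thesis using a y by (auto simp: M_def anc_def)
  qed
  have finM: "finite M" using M_less by (meson bounded_nat_set_is_finite)
  define m where "m = Max M"
  have "m \<in> M" using \<open>0 \<in> M\<close> Max_in[OF finM] by (auto simp: m_def)
  moreover have "Suc m \<notin> M" using Max_ge[OF finM, of "Suc m"] by (auto simp: m_def)
  ultimately have "m \<in> M" "Suc m \<notin> M" by auto
  then obtain a y b where ab: "a \<in> W" "y \<in> W" "b \<in> W" "R a y" "R y b" "dep a = i" "anc m a \<noteq> anc m b"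
    by (auto simp: M_def)
  have mi: "m < i" using M_less \<open>m \<in> M\<close> by blast
  define r where "r = l - Suc m"
  have r: "r \<ge> 1" using mi il by (simp add: r_def)
  have "\<exists>xs. length xs = 2 * r + 1 \<and> distinct xs \<and> set xs \<subseteq> W \<and> successively R xs \<and>
      dep (hd xs) = i \<and> (anc m (hd xs) = anc m a) \<noteq> (anc m (last xs) = anc m a)"
  proof (rule bicoloured_path[of W r R "\<lambda>x. dep x = i" a y b "\<lambda>x. anc m x = anc m a"])
    show "4 * r + 2 < card {u \<in> W. R w u}" if "w \<in> W" for w using deg[OF that] il by (simp add: r_def)
    show "(dep u = i) = (dep v \<noteq> i)" if "R u v" for u v using lev[OF that] by auto
  qed (use symR ab r in auto)
  then obtain xs where xs: "length xs = 2 * r + 1" "distinct xs" "set xs \<subseteq> W" "successively R xs"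
      "dep (hd xs) = i" "anc m (hd xs) \<noteq> anc m (last xs)" by metis
  define x x' where "x = hd xs" and "x' = last xs"
  have xne: "xs \<noteq> []" using xs(1) by auto
  have "anc (Suc m) x = anc (Suc m) x' \<and> dep x' = i" unfolding x_def x'_def
    by (rule path_invariant_on_even_vertices[of R W "\<lambda>x. dep x = i"])
       (use xs ch \<open>Suc m \<notin> M\<close> in \<open>auto simp: M_def\<close>)
  then have z: "anc (Suc m) x = anc (Suc m) x'" "dep x' = i" "dep x = i" using xs by (auto simp: x_def)
  have xV: "x \<in> V" "x' \<in> V" 
    using hd_in_set[OF xne] last_in_set[OF xne] xs(3) W unfolding x_def x'_def by blast+
  \<comment> \<open>The cycle climbs from \<open>x'\<close> and descends to \<open>x\<close>. The
    common ancestor is listed in \<open>us\<close> only, so the number of vertices is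
    \<open>(2 * r + 1) + (m + 1) + m = 2 * l\<close>.\<close>
  define us where "us = map (\<lambda>j. anc j x') [1..<m+2]"
  define ws where "ws = map (\<lambda>j. anc j x) [1..<m+1]"
  let ?c = "xs @ us @ rev ws"
  \<comment> \<open>The path lies on levels \<open>i\<close> and \<open>i + 1\<close>, proper
    ancestors of its ends lie below level \<open>i\<close>; hence the path meets the two tree paths
    only in \<open>x\<close> and \<open>x'\<close>.\<close>
  have depxs: "dep v \<ge> i" if "v \<in> set xs" for v
  proof -
    have "\<exists>u. R u v \<or> R v u" using nb that xs(3) by blast
    then show ?thesis using lev by fastforce
  qed
  have depus: "anc j v \<in> V \<and> dep (anc j v) = i - j" if "j \<le> Suc m" "v \<in> {x, x'}" for j v
    using anc[of v j] that z mi xV by auto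
  have inj: "inj_on (\<lambda>j. anc j v) {1..<m+2}" if "v \<in> {x, x'}" for v
  proof (rule inj_onI)
    fix j j' assume "j \<in> {1..<m+2}" "j' \<in> {1..<m+2}" "anc j v = anc j' v"
    then have "i - j = i - j'" "j \<le> i" "j' \<le> i" using depus[of j v] depus[of j' v] that mi by auto
    then show "j = j'" by simp
  qed
  have neq: "anc j x \<noteq> anc j' x'" if "j \<le> m" "j' \<le> Suc m" "1 \<le> j" "1 \<le> j'" for j j'
  proof
    assume eq: "anc j x = anc j' x'"
    then have "i - j = i - j'" using depus[of j x] depus[of j' x'] that by auto
    then have "j = j'" using that mi by simp
    then have "anc m x = anc m x'" using anc_mono[of j x x' m] eq that by simp
    then show False using xs(6) by (simp add: x_def x'_def)
  qed
  have "distinct ?c"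
  proof -
    have "distinct us" using inj[of x'] unfolding us_def distinct_map by (simp del: upt_Suc)
    moreover have "distinct ws" using inj_on_subset[OF inj[of x], of "{1..<m+1}"]
      unfolding ws_def distinct_map by (simp del: upt_Suc)
    moreover have "set us \<inter> set ws = {}" using neq by (fastforce simp: us_def ws_def)
    moreover have "set xs \<inter> set us = {}" using depus depxs mi unfolding us_def by fastforce
    moreover have "set xs \<inter> set ws = {}" using depus depxs mi unfolding ws_def by fastforce
    ultimately show ?thesis using xs(2) by auto
  qed
  moreover have "set ?c \<subseteq> V" using xs(3) W depus by (auto simp: us_def ws_def)
  moreover have "length ?c = 2 * l" using xs(1) mi il by (auto simp: us_def ws_def r_def)
  moreover have "successively E ?c"
  proof -
    have "successively E xs" using xs(4) RE by (rule successively_mono)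
    moreover have "successively E us" unfolding us_def
      using ancS[of x'] xV z mi symE by (auto simp: successively_conv_nth simp del: upt_Suc)
    moreover have "successively E (rev ws)" unfolding ws_def successively_rev
      using ancS[of x] xV z mi by (auto simp: successively_conv_nth simp del: upt_Suc)
    moreover have "hd us = anc 1 x'" unfolding us_def by (simp del: upt_Suc add: hd_map)
    moreover have "last us = anc (Suc m) x" unfolding us_def using z by (simp add: last_map)
    moreover have "hd (rev ws) = anc m x" if "m > 0" unfolding ws_def hd_rev using that by (simp add: last_map)
    moreover have "E x' (anc 1 x')" "E (anc (Suc m) x) (anc m x)"
      using ancS[of x' 0] ancS[of x m] symE xV z mi by (auto simp: anc_def)
    moreover have "us \<noteq> []" "m = 0 \<Longrightarrow> ws = []" by (auto simp: us_def ws_def)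
    ultimately show ?thesis using xne by (cases "m = 0") (auto simp: successively_append_iff x'_def hd_append)
  qed
  moreover have "E (last ?c) (hd ?c)"
  proof (cases "m = 0")
    case True
    then have "ws = []" by (simp add: ws_def)
    moreover have "last us = anc (Suc m) x" unfolding us_def using z by (simp add: last_map)
    moreover have "us \<noteq> []" by (simp add: us_def)
    ultimately show ?thesis using ancS[of x 0] xV z mi True xne by (simp add: anc_def x_def)
  next
    case False
    then have "ws \<noteq> []" "hd ws = anc 1 x" unfolding ws_def by (simp_all del: upt_Suc add: hd_map)
    then show ?thesis using ancS[of x 0] xV z mi xne by (simp add: last_rev anc_def x_def)
  qed
  ultimately show ?thesis using xne unfolding contains_cycle_def by blast
qed

section \<open>Degenerate graphs and maximum cuts\<close>

abbreviation nbhd :: "('a \<Rightarrow> 'a \<Rightarrow> bool) \<Rightarrow> 'a set \<Rightarrow> 'a \<Rightarrow> 'a set" where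
  "nbhd R V w \<equiv> {u\<in>V. R w u}"

text \<open>Ordered pairs: an edge of a loopless symmetric relation counts twice, which accounts for
  the factors 2 below.\<close>

definition adj_pairs :: "('a \<Rightarrow> 'a \<Rightarrow> bool) \<Rightarrow> 'a set \<Rightarrow> ('a \<times> 'a) set" where
  "adj_pairs R V = {(u, v). u \<in> V \<and> v \<in> V \<and> R u v}"

lemma finite_adj_pairs [simp]: "finite V \<Longrightarrow> finite (adj_pairs R V)"
  by (rule finite_subset[of _ "V \<times> V"]) (auto simp: adj_pairs_def)

lemma card_adj_pairs: "finite V \<Longrightarrow> card (adj_pairs R V) = (\<Sum>v\<in>V. card (nbhd R V v))"
proof -
  assume "finite V"
  have "adj_pairs R V = Sigma V (nbhd R V)" by (auto simp: adj_pairs_def)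
  then show ?thesis using \<open>finite V\<close> by simp
qed

lemma adj_pairs_remove:
  assumes "w \<in> V" "\<And>u v. R u v \<Longrightarrow> R v u"
  shows "adj_pairs R V = adj_pairs R (V - {w}) \<union> (Pair w ` nbhd R V w \<union> (\<lambda>u. (u, w)) ` nbhd R V w)"
  unfolding adj_pairs_def using assms by blast

lemma card_adj_pairs_remove:
  assumes "finite V" "w \<in> V" "\<And>u v. R u v \<Longrightarrow> R v u"
  shows "card (adj_pairs R V) \<le> card (adj_pairs R (V - {w})) + 2 * card (nbhd R V w)"
    and "\<not> R w w \<Longrightarrow> card (adj_pairs R V) = card (adj_pairs R (V - {w})) + 2 * card (nbhd R V w)"
proof -
  let ?N = "nbhd R V w"
  have fin: "finite (adj_pairs R (V - {w}))" "finite ?N" using assms(1) by auto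
  have N: "card (Pair w ` ?N) = card ?N" "card ((\<lambda>u. (u, w)) ` ?N) = card ?N"
    by (intro card_image inj_onI; simp)+
  have eq: "adj_pairs R V = adj_pairs R (V - {w}) \<union> (Pair w ` ?N \<union> (\<lambda>u. (u, w)) ` ?N)"
    by (rule adj_pairs_remove) (fact assms)+
  have "card (Pair w ` ?N \<union> (\<lambda>u. (u, w)) ` ?N) \<le> 2 * card ?N"
    using card_Un_le[of "Pair w ` ?N" "(\<lambda>u. (u, w)) ` ?N"] N by simp
  then show "card (adj_pairs R V) \<le> card (adj_pairs R (V - {w})) + 2 * card ?N"
    unfolding eq
    using card_Un_le[of "adj_pairs R (V - {w})" "Pair w ` ?N \<union> (\<lambda>u. (u, w)) ` ?N"] by linarith
  assume "\<not> R w w"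
  then have "Pair w ` ?N \<inter> (\<lambda>u. (u, w)) ` ?N = {}" by auto
  then have c2: "card (Pair w ` ?N \<union> (\<lambda>u. (u, w)) ` ?N) = 2 * card ?N"
    using fin N by (subst card_Un_disjoint) auto
  have "adj_pairs R (V - {w}) \<inter> (Pair w ` ?N \<union> (\<lambda>u. (u, w)) ` ?N) = {}"
    by (auto simp: adj_pairs_def)
  then have "card (adj_pairs R (V - {w}) \<union> (Pair w ` ?N \<union> (\<lambda>u. (u, w)) ` ?N)) =
      card (adj_pairs R (V - {w})) + card (Pair w ` ?N \<union> (\<lambda>u. (u, w)) ` ?N)"
    using fin by (intro card_Un_disjoint) auto
  then show "card (adj_pairs R V) = card (adj_pairs R (V - {w})) + 2 * card ?N"
    unfolding eq c2 .
qed

definition degenerate :: "('a \<Rightarrow> 'a \<Rightarrow> bool) \<Rightarrow> nat \<Rightarrow> 'a set \<Rightarrow> bool" where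
  "degenerate R D V \<longleftrightarrow> (\<forall>W\<subseteq>V. W \<noteq> {} \<longrightarrow> (\<exists>w\<in>W. card (nbhd R W w) \<le> D))"

lemma degenerate_induct [consumes 2, case_names empty remove]:
  assumes "finite V" "degenerate R D V"
    and "P {}"
    and "\<And>V w. finite V \<Longrightarrow> w \<in> V \<Longrightarrow> card (nbhd R V w) \<le> D \<Longrightarrow> P (V - {w}) \<Longrightarrow> P V"
  shows "P V"
  using assms(1,2)
proof (induction V rule: finite_psubset_induct)
  case (psubset V)
  show ?case
  proof (cases "V = {}")
    case False
    then obtain w where w: "w \<in> V" "card (nbhd R V w) \<le> D"
      using psubset.prems by (auto simp: degenerate_def)
    have "degenerate R D (V - {w})" using psubset.prems unfolding degenerate_def by blast
    then have "P (V - {w})" using w by (intro psubset.IH) auto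
    then show ?thesis using assms(4) w psubset.hyps by blast
  qed (use assms(3) in simp)
qed

lemma degenerate_card_adj_pairs:
  assumes "finite V" "degenerate R D V" "\<And>u v. R u v \<Longrightarrow> R v u"
  shows "card (adj_pairs R V) \<le> 2 * D * card V"
  using assms(1,2)
proof (induction rule: degenerate_induct)
  case empty
  then show ?case by (simp add: adj_pairs_def)
next
  case (remove V w)
  have cV: "card V = Suc (card (V - {w}))" using remove.hyps by (simp only: card_Suc_Diff1)
  have "card (adj_pairs R V) \<le> card (adj_pairs R (V - {w})) + 2 * card (nbhd R V w)"
    by (rule card_adj_pairs_remove(1)) (fact remove.hyps assms(3))+
  also have "\<dots> \<le> 2 * D * card (V - {w}) + 2 * D"
    using remove by (intro add_mono) auto
  also have "\<dots> = 2 * D * card V"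
    by (simp add: cV algebra_simps)
  finally show ?case .
qed

text \<open>Remove a vertex \<open>w\<close> of degree at most \<open>D\<close>: a clique through
  \<open>w\<close> is determined by a subset of the neighbourhood of \<open>w\<close>, so at most
  \<open>2 ^ D\<close> cliques are lost. The summand 1 is the empty clique.\<close>

lemma degenerate_card_cliques:
  assumes "finite V" "degenerate R D V" 
    and "L \<subseteq> Pow V" "\<And>f u v. f \<in> L \<Longrightarrow> u \<in> f \<Longrightarrow> v \<in> f \<Longrightarrow> u \<noteq> v \<Longrightarrow> R u v"
  shows "card L \<le> 1 + card V * 2 ^ D"
  using assms
proof (induction arbitrary: L rule: degenerate_induct)
  case (empty L)
  then have "L \<subseteq> {{}}" by auto
  then have "card L \<le> 1" using card_mono[of "{{}}" L] by simp
  then show ?case by simp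
next
  case (remove V w L)
  let ?A = "{f\<in>L. w \<notin> f}" and ?B = "{f\<in>L. w \<in> f}"
  have "card L \<le> card ?A + card ?B" 
  proof -
    have "L = ?A \<union> ?B" by blast
    then show ?thesis using card_Un_le[of ?A ?B] by simp
  qed
  moreover have "card ?A \<le> 1 + card (V - {w}) * 2 ^ D"
    using remove.prems by (intro remove.IH) auto
  moreover have "card ?B \<le> 2 ^ D"
  proof -
    have "inj_on (\<lambda>f. f - {w}) ?B" by (auto intro!: inj_onI)
    moreover have "(\<lambda>f. f - {w}) ` ?B \<subseteq> Pow (nbhd R V w)" using remove.prems by fastforce
    ultimately have "card ?B \<le> card (Pow (nbhd R V w))"
      using remove.hyps by (intro card_inj_on_le) auto
    also have "\<dots> \<le> 2 ^ D" using remove.hyps by (simp add: card_Pow)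
    finally show ?thesis .
  qed
  moreover have "card V = Suc (card (V - {w}))" using remove.hyps by (simp only: card_Suc_Diff1)
  ultimately show ?case by simp
qed

text \<open>Take \<open>A\<close> with the most crossing pairs. Moving \<open>v\<close> to the other
  side exchanges its crossing and non-crossing neighbours, so by maximality at least half of its
  neighbours are across.\<close>

lemma max_cut:
  assumes "finite V" "\<And>u v. R u v \<Longrightarrow> R v u" "\<And>u. \<not> R u u"
  shows "\<exists>A\<subseteq>V. \<forall>v\<in>V. card (nbhd R V v) \<le> 2 * card {u\<in>V. R v u \<and> (u \<in> A) \<noteq> (v \<in> A)}"
proof -
  define f where "f = (\<lambda>A. card (adj_pairs (\<lambda>u v. R u v \<and> (v \<in> A) \<noteq> (u \<in> A)) V))"
  have "f A < Suc (card (V \<times> V))" for A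
    unfolding f_def less_Suc_eq_le using assms(1) by (intro card_mono) (auto simp: adj_pairs_def)
  then have "\<exists>A. A \<subseteq> V \<and> (\<forall>B. B \<subseteq> V \<longrightarrow> f B \<le> f A)"
    by (intro ex_has_greatest_nat[of _ "{}" _ "Suc (card (V \<times> V))"]) auto
  then obtain A where A: "A \<subseteq> V" "\<And>B. B \<subseteq> V \<Longrightarrow> f B \<le> f A" by blast
  have "card (nbhd R V v) \<le> 2 * card {u\<in>V. R v u \<and> (u \<in> A) \<noteq> (v \<in> A)}" if v: "v \<in> V" for v
  proof -
    define B where "B = (if v \<in> A then A - {v} else insert v A)"
    have B: "B \<subseteq> V" "\<And>u. u \<noteq> v \<Longrightarrow> (u \<in> B) = (u \<in> A)" "(v \<in> B) = (v \<notin> A)"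
      using A v by (auto simp: B_def split: if_splits)
    \<comment> \<open>Only the second summand changes when \<open>v\<close> switches sides.\<close>
    have split: "f C = card (adj_pairs (\<lambda>u v. R u v \<and> (v \<in> C) \<noteq> (u \<in> C)) (V - {v})) +
        2 * card {u\<in>V. R v u \<and> (u \<in> C) \<noteq> (v \<in> C)}" for C
      unfolding f_def
    proof (rule card_adj_pairs_remove(2))
      show "R u w \<and> (w \<in> C) \<noteq> (u \<in> C) \<Longrightarrow> R w u \<and> (u \<in> C) \<noteq> (w \<in> C)" for u w
        using assms(2) by blast
    qed (use assms(1) v in auto)
    have "adj_pairs (\<lambda>u v. R u v \<and> (v \<in> B) \<noteq> (u \<in> B)) (V - {v}) = adj_pairs (\<lambda>u v. R u v \<and> (v \<in> A) \<noteq> (u \<in> A)) (V - {v})"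
      using B by (auto simp: adj_pairs_def)
    then have "card {u\<in>V. R v u \<and> (u \<in> B) \<noteq> (v \<in> B)} \<le> card {u\<in>V. R v u \<and> (u \<in> A) \<noteq> (v \<in> A)}"
      using A(2)[OF B(1)] split[of A] split[of B] by simp
    moreover have "{u\<in>V. R v u \<and> (u \<in> B) \<noteq> (v \<in> B)} = {u\<in>V. R v u \<and> (u \<in> A) = (v \<in> A)}"
    proof (intro Collect_cong conj_cong refl)
      fix u assume "R v u"
      then have "u \<noteq> v" using assms(3) by blast
      then show "((u \<in> B) \<noteq> (v \<in> B)) = ((u \<in> A) = (v \<in> A))" using B by simp
    qed
    moreover have "card (nbhd R V v) \<le> card {u\<in>V. R v u \<and> (u \<in> A) = (v \<in> A)} + card {u\<in>V. R v u \<and> (u \<in> A) \<noteq> (v \<in> A)}"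
      by (rule order_trans[OF card_mono card_Un_le]) (use assms(1) in auto)
    ultimately show ?thesis by simp
  qed
  then show ?thesis using A(1) by blast
qed

section \<open>Graphs without a given even cycle\<close>

lemma contains_cycle_mono:
  assumes "contains_cycle E m V" "V \<subseteq> W" "\<And>u v. E u v \<Longrightarrow> F u v"
  shows "contains_cycle F m W"
proof -
  obtain xs where xs: "length xs = m" "distinct xs" "set xs \<subseteq> V" "xs \<noteq> []" "successively E xs" "E (last xs) (hd xs)"
    using assms(1) by (auto simp: contains_cycle_def)
  have "successively F xs" using xs(5) assms(3) by (rule successively_mono)
  then show ?thesis
    unfolding contains_cycle_def using xs assms(2,3) by (intro exI[of _ xs]) simp
qed

text \<open>These are balls; the spheres are the differences \<open>L\<close> in
  \<open>bfs_growth\<close>.\<close>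

fun bfs :: "('a \<Rightarrow> 'a \<Rightarrow> bool) \<Rightarrow> 'a set \<Rightarrow> 'a \<Rightarrow> nat \<Rightarrow> 'a set" where
  "bfs E V v 0 = {v}"
| "bfs E V v (Suc n) = bfs E V v n \<union> {w\<in>V. \<exists>u\<in>bfs E V v n. E u w}"

text \<open>Two consecutive spheres span a \<open>4 * l\<close>-degenerate graph, since a subset of
  larger minimum degree would give the forbidden cycle by \<open>tree_cycle\<close>. So few edges
  run between them. As the graph is bipartite, all the at least \<open>\<delta>\<close> neighbours
  of a vertex lie in the two adjacent spheres, and each of the first \<open>l\<close> steps enlarges
  the sphere by a factor of at least \<open>\<delta> / (16 * l)\<close>.\<close>

lemma bfs_growth:
  fixes s :: "'a \<Rightarrow> bool"
  assumes V: "finite V" "v0 \<in> V"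
    and symE: "\<And>u v. E u v \<Longrightarrow> E v u"
    and bip: "\<And>u v. E u v \<Longrightarrow> s u \<noteq> s v"
    and deg: "\<And>v. v \<in> V \<Longrightarrow> \<delta> \<le> card (nbhd E V v)"
    and nocyc: "\<not> contains_cycle E (2 * l) V"
    and \<delta>: "48 * l \<le> \<delta>"
  shows "\<delta> ^ l \<le> (16 * l) ^ l * card V"
proof -
  define B where "B = bfs E V v0"
  define L where "L = (\<lambda>j. {w \<in> B j. \<forall>i<j. w \<notin> B i})"
  define dep where "dep = (\<lambda>w. LEAST j. w \<in> B j)"
  define U where "U = (\<Union>j. B j)"
  have BV: "B j \<subseteq> V" for j by (induction j) (use V in \<open>auto simp: B_def\<close>)
  have BS: "w \<in> B (Suc j)" if "w \<in> V" "u \<in> B j" "E u w" for u w j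
    using that by (auto simp: B_def)
  have L_V: "L j \<subseteq> V" for j using BV by (auto simp: L_def)
  then have finL: "finite (L j)" for j using V(1) finite_subset by blast
  have L_dep: "dep w = j" if "w \<in> L j" for w j
    unfolding dep_def using that by (intro Least_equality) (auto simp: L_def not_less[symmetric])
  have dep_L: "w \<in> L (dep w)" if "w \<in> U" for w
    using that unfolding L_def dep_def U_def by (auto intro: LeastI dest: not_less_Least)
  have LU: "L j \<subseteq> U" for j by (auto simp: L_def U_def)
  have parent: "\<exists>u\<in>L j. E u w" if w: "w \<in> L (Suc j)" for w j
  proof -
    have "w \<in> B (Suc j)" "w \<notin> B j" using w by (auto simp: L_def)
    then obtain u where u: "u \<in> B j" "E u w" by (auto simp: B_def)
    have "u \<notin> B i" if "i < j" for i
    proof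
      assume "u \<in> B i"
      then have "w \<in> B (Suc i)" using BS u w L_V by blast
      then show False using w that by (auto simp: L_def)
    qed
    then show ?thesis using u by (auto simp: L_def)
  qed
  have parity: "s w = (s v0 = even j)" if "w \<in> L j" for w j
    using that
  proof (induction j arbitrary: w)
    case 0 then show ?case by (simp add: L_def B_def)
  next
    case (Suc j)
    then obtain u where "u \<in> L j" "E u w" using parent by blast
    then show ?case using Suc.IH bip by fastforce
  qed
  have nb: "w \<in> L (Suc j) \<or> 0 < j \<and> w \<in> L (j - 1)" if "u \<in> L j" "w \<in> V" "E u w" for u w j
  proof -
    have "w \<in> B (Suc j)" using BS that by (auto simp: L_def)
    then have wU: "w \<in> U" and "dep w \<le> Suc j" by (auto simp: U_def dep_def intro: Least_le)
    have "w \<in> L (dep w)" using dep_L wU by blast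
    then have "w \<in> B (dep w)" by (simp add: L_def)
    then have "u \<in> B (Suc (dep w))" using BS that symE L_V by blast
    then have "j \<le> Suc (dep w)" using that(1) by (auto simp: L_def not_less[symmetric])
    \<comment> \<open>Adjacent vertices have different colours, while the colour is constant on each
      sphere.\<close>
    moreover have "dep w \<noteq> j" using parity[OF that(1)] parity[of w "dep w"] \<open>w \<in> L (dep w)\<close> bip[OF that(3)] by metis
    ultimately have "dep w = Suc j \<or> 0 < j \<and> dep w = j - 1" using \<open>dep w \<le> Suc j\<close> by linarith
    then show ?thesis using \<open>w \<in> L (dep w)\<close> by metis
  qed
  define p where "p = (\<lambda>w. SOME u. u \<in> L (dep w - 1) \<and> E u w)"
  have p: "p w \<in> U \<and> E (p w) w \<and> dep (p w) = dep w - 1" if "w \<in> U" "0 < dep w" for w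
  proof -
    have "\<exists>u. u \<in> L (dep w - 1) \<and> E u w" using parent[of w "dep w - 1"] dep_L[of w] that by auto
    from someI_ex[OF this] have "p w \<in> L (dep w - 1)" "E (p w) w" by (auto simp: p_def)
    then show ?thesis using L_dep LU by blast
  qed
  have root: "w = v0" if "w \<in> U" "dep w = 0" for w
    using dep_L[OF that(1)] that(2) by (simp add: L_def B_def)
  define R where "R = (\<lambda>i u v. E u v \<and> (u \<in> L i \<and> v \<in> L (Suc i) \<or> u \<in> L (Suc i) \<and> v \<in> L i))"
  have symR: "R i u v \<Longrightarrow> R i v u" for i u v using symE by (auto simp: R_def)
  have dg: "degenerate (R i) (4 * l) (L i \<union> L (Suc i))" if "i < l" for i
    unfolding degenerate_def
  proof (intro allI impI, rule ccontr)
    fix W assume W: "W \<subseteq> L i \<union> L (Suc i)" "W \<noteq> {}" "\<not> (\<exists>w\<in>W. card (nbhd (R i) W w) \<le> 4 * l)"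
    have "contains_cycle E (2 * l) U"
    proof (rule tree_cycle[where R = "R i" and W = W and dep = dep and p = p and i = i])
      show "W \<subseteq> U" using W LU by blast
      show "dep u = i \<and> dep v = Suc i \<or> dep u = Suc i \<and> dep v = i" if "R i u v" for u v
        using that L_dep by (auto simp: R_def)
      show "4 * l < card (nbhd (R i) W w)" if "w \<in> W" for w using W that by (auto simp: not_le)
      show "R i u v \<Longrightarrow> E u v" for u v by (simp add: R_def)
    qed (use W symE symR p root that in blast)+
    then show False using nocyc contains_cycle_mono[of E "2 * l" U V E] BV by (auto simp: U_def)
  qed
  have pairs: "card (adj_pairs (R i) (L i \<union> L (Suc i))) \<le> 8 * l * (card (L i) + card (L (Suc i)))" if "i < l" for i
  proof -
    have "card (adj_pairs (R i) (L i \<union> L (Suc i))) \<le> 2 * (4 * l) * card (L i \<union> L (Suc i))"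
      by (rule degenerate_card_adj_pairs[OF _ dg[OF that] symR]) (use finL in auto)
    also have "\<dots> \<le> 2 * (4 * l) * (card (L i) + card (L (Suc i)))"
      by (intro mult_left_mono card_Un_le) auto
    finally show ?thesis by simp
  qed
  have sig: "\<delta> * card (L j) \<le> card (Sigma (L j) (nbhd E V))" for j
  proof -
    have "\<delta> * card (L j) = (\<Sum>u\<in>L j. \<delta>)" by simp
    also have "\<dots> \<le> (\<Sum>u\<in>L j. card (nbhd E V u))" using deg L_V by (intro sum_mono) auto
    also have "\<dots> = card (Sigma (L j) (nbhd E V))" using finL V by simp
    finally show ?thesis .
  qed
  \<comment> \<open>Monotonicity is carried along to absorb the previous sphere: pairs going back
    and the own sphere contribute at most \<open>24 * l * card (L j)\<close>, which is at most half
    of \<open>\<delta> * card (L j)\<close> because \<open>48 * l \<le> \<delta>\<close>. The other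
    half is bounded by \<open>8 * l\<close> times the next sphere.\<close>
  have step: "card (L j) \<le> card (L (Suc j)) \<and> \<delta> * card (L j) \<le> 16 * l * card (L (Suc j))" if "j < l" for j
    using that
  proof (induction j)
    case 0
    have "Sigma (L 0) (nbhd E V) \<subseteq> adj_pairs (R 0) (L 0 \<union> L (Suc 0))"
      using nb by (fastforce simp: adj_pairs_def R_def)
    then have "card (Sigma (L 0) (nbhd E V)) \<le> card (adj_pairs (R 0) (L 0 \<union> L (Suc 0)))"
      using finL by (intro card_mono) auto
    then have *: "\<delta> * card (L 0) \<le> 8 * l * (card (L 0) + card (L (Suc 0)))"
      using pairs[OF 0] sig[of 0] by linarith
    from * have "\<delta> * card (L 0) \<le> 8 * (l * card (L 0)) + 8 * (l * card (L (Suc 0)))"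
      by (simp add: algebra_simps)
    moreover have "48 * (l * card (L 0)) \<le> \<delta> * card (L 0)"
      using mult_right_mono[OF \<delta>, of "card (L 0)"] by (simp only: mult.assoc)
    ultimately have "l * card (L 0) \<le> l * card (L (Suc 0))" "\<delta> * card (L 0) \<le> 16 * (l * card (L (Suc 0)))"
      by linarith+
    then show ?case using 0 by (auto simp: mult.assoc)
  next
    case (Suc j)
    let ?A = "adj_pairs (R (Suc j)) (L (Suc j) \<union> L (Suc (Suc j)))" and ?B = "adj_pairs (R j) (L j \<union> L (Suc j))"
    have "Sigma (L (Suc j)) (nbhd E V) \<subseteq> ?A \<union> ?B"
      using nb by (fastforce simp: adj_pairs_def R_def)
    then have "card (Sigma (L (Suc j)) (nbhd E V)) \<le> card (?A \<union> ?B)"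
      using finL by (intro card_mono) auto
    also have "\<dots> \<le> card ?A + card ?B" by (rule card_Un_le)
    finally have *: "\<delta> * card (L (Suc j)) \<le> 8 * l * (card (L (Suc j)) + card (L (Suc (Suc j)))) + 8 * l * (card (L j) + card (L (Suc j)))"
      using pairs[of j] pairs[of "Suc j"] sig[of "Suc j"] Suc.prems by linarith
    have "l * card (L j) \<le> l * card (L (Suc j))" using Suc by simp
    then have **: "\<delta> * card (L (Suc j)) \<le> 24 * (l * card (L (Suc j))) + 8 * (l * card (L (Suc (Suc j))))"
    proof -
      have "\<delta> * card (L (Suc j)) \<le> 8 * (l * card (L j)) + 16 * (l * card (L (Suc j))) + 8 * (l * card (L (Suc (Suc j))))"
        using * by (simp add: algebra_simps)
      then show ?thesis using \<open>l * card (L j) \<le> l * card (L (Suc j))\<close> by linarith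
    qed
    have ***: "48 * (l * card (L (Suc j))) \<le> \<delta> * card (L (Suc j))"
      using mult_right_mono[OF \<delta>, of "card (L (Suc j))"] by (simp only: mult.assoc)
    then have "l * card (L (Suc j)) \<le> l * card (L (Suc (Suc j)))" using ** by linarith
    moreover have "\<delta> * card (L (Suc j)) \<le> 16 * (l * card (L (Suc (Suc j))))"
      using ** *** by linarith
    ultimately show ?case using Suc.prems by (auto simp: algebra_simps)
  qed
  have "\<delta> ^ j \<le> (16 * l) ^ j * card (L j)" if "j \<le> l" for j
    using that
  proof (induction j)
    case 0
    then show ?case by (simp add: L_def B_def)
  next
    case (Suc j)
    then have "\<delta> * \<delta> ^ j \<le> \<delta> * ((16 * l) ^ j * card (L j))" by (intro mult_left_mono) auto
    also have "\<dots> = (16 * l) ^ j * (\<delta> * card (L j))" by simp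
    also have "\<dots> \<le> (16 * l) ^ j * (16 * l * card (L (Suc j)))" using step[of j] Suc.prems by (intro mult_left_mono) auto
    finally show ?case by (simp add: mult_ac)
  qed
  then have "\<delta> ^ l \<le> (16 * l) ^ l * card (L l)" by simp
  also have "\<dots> \<le> (16 * l) ^ l * card V" using card_mono[OF V(1) L_V] by (intro mult_left_mono) auto
  finally show ?thesis .
qed

text \<open>A subset with all degrees above \<open>2 * \<delta>\<close> has a maximum cut with all
  degrees at least \<open>\<delta>\<close>; this bipartite graph would have to contain more vertices
  than there are, by \<open>bfs_growth\<close>.\<close>

lemma even_cycle_free_degenerate:
  assumes "finite V" "\<And>u v. E u v \<Longrightarrow> E v u" "\<And>u. \<not> E u u" "\<not> contains_cycle E (2 * l) V"
    and "48 * l \<le> \<delta>" "(16 * l) ^ l * card V < \<delta> ^ l"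
  shows "degenerate E (2 * \<delta>) V"
  unfolding degenerate_def
proof (intro allI impI, rule ccontr)
  fix W assume W: "W \<subseteq> V" "W \<noteq> {}" "\<not> (\<exists>w\<in>W. card (nbhd E W w) \<le> 2 * \<delta>)"
  have fW: "finite W" using W(1) assms(1) finite_subset by blast
  obtain A where A: "\<And>v. v \<in> W \<Longrightarrow> card (nbhd E W v) \<le> 2 * card {u\<in>W. E v u \<and> (u \<in> A) \<noteq> (v \<in> A)}"
    using max_cut[of W E, OF fW assms(2,3)] by blast
  obtain v0 where "v0 \<in> W" using W by blast
  have "\<delta> ^ l \<le> (16 * l) ^ l * card W"
  proof (rule bfs_growth[where E = "\<lambda>u v. E u v \<and> (v \<in> A) \<noteq> (u \<in> A)" and s = "\<lambda>v. v \<in> A"])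
    show "\<delta> \<le> card {u \<in> W. E v u \<and> (u \<in> A) \<noteq> (v \<in> A)}" if "v \<in> W" for v
      using A[OF that] W(3) that by (fastforce simp: not_le)
    show "\<not> contains_cycle (\<lambda>u v. E u v \<and> (v \<in> A) \<noteq> (u \<in> A)) (2 * l) W"
      using assms(4) contains_cycle_mono[OF _ W(1), of _ "2 * l" E] by blast
  qed (use fW \<open>v0 \<in> W\<close> assms(2,5) in auto)
  also have "\<dots> \<le> (16 * l) ^ l * card V" using card_mono[OF assms(1) W(1)] by simp
  finally show False using assms(6) by simp
qed

text \<open>Large minimum degree inside the neighbourhood of \<open>v\<close> yields a path on
  \<open>2 * l - 1\<close> vertices there, which \<open>v\<close> closes to a cycle of length
  \<open>2 * l\<close>.\<close>

lemma nbhd_degenerate: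
  assumes "\<And>u v. E u v \<Longrightarrow> E v u" "\<And>u. \<not> E u u" "\<not> contains_cycle E (2 * l) V" "v \<in> V" "l \<ge> 1"
  shows "degenerate E (2 * l) (nbhd E V v)"
  unfolding degenerate_def
proof (intro allI impI, rule ccontr)
  fix W assume W: "W \<subseteq> nbhd E V v" "W \<noteq> {}" "\<not> (\<exists>w\<in>W. card (nbhd E W w) \<le> 2 * l)"
  obtain w where w: "w \<in> W" using W by blast
  obtain ys where ys: "length ys = 2 * l - 2" "distinct ([w] @ ys)" "set ys \<subseteq> W - {}" "successively E ([w] @ ys)"
    using extend_path[of W "2 * l" E "{}" "[w]" "2 * l - 2"] W w assms(5) by (auto simp: not_le)
  have "set (w # ys) \<subseteq> W" using ys w by auto
  then have "v \<notin> set (w # ys)" "E v w" "E (last (w # ys)) v" 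
    using W(1) assms(1,2) w last_in_set[of "w # ys"] by blast+
  then have "contains_cycle E (2 * l) V"
    unfolding contains_cycle_def using ys W(1) assms(4,5) \<open>set (w # ys) \<subseteq> W\<close>
    by (intro exI[of _ "v # w # ys"]) auto
  then show False using assms(3) by blast
qed

lemma card_cliques_even_cycle_free:
  assumes "finite V" "card V \<le> n" "n \<ge> 1" "l \<ge> 1"
    and sym: "\<And>u v. E u v \<Longrightarrow> E v u" and irr: "\<And>u. \<not> E u u" and nocyc: "\<not> contains_cycle E (2 * l) V"
    and L: "L \<subseteq> Pow V" "\<And>f u v. f \<in> L \<Longrightarrow> u \<in> f \<Longrightarrow> v \<in> f \<Longrightarrow> u \<noteq> v \<Longrightarrow> E u v"
  shows "real (card L) \<le> (2 + 196 * real l * 4 ^ l) * real n powr (1 + 1 / l)"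
proof -
  define x where "x = real n powr (1 / l)"
  have x1: "x \<ge> 1" using assms(3) by (simp add: x_def ge_one_powr_ge_zero)
  have xl: "x ^ l = n" using assms(3,4) by (simp add: x_def powr_power)
  \<comment> \<open>Any factor above 16 gives \<open>(16 * l) ^ l * n < \<delta> ^ l\<close>; 48
    also meets the second requirement of \<open>bfs_growth\<close>. Rounding up costs at most
    \<open>1 \<le> l * x\<close>, hence 49 in the upper bound.\<close>
  define \<delta> where "\<delta> = nat \<lceil>48 * l * x\<rceil>"
  have \<delta>1: "48 * l * x \<le> real \<delta>" unfolding \<delta>_def by linarith
  have "1 \<le> real l * x" using assms(4) x1 mult_mono[of 1 "real l" 1 x] by simp
  then have \<delta>2: "real \<delta> \<le> 49 * l * x" unfolding \<delta>_def by linarith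
  have "degenerate E (2 * \<delta>) V"
  proof (rule even_cycle_free_degenerate[OF assms(1) sym irr nocyc])
    have "48 * real l * 1 \<le> 48 * real l * x" using x1 by (intro mult_left_mono) auto
    then have "real (48 * l) \<le> real \<delta>" using \<delta>1 by linarith
    then show "48 * l \<le> \<delta>" by linarith
    have "real ((16 * l) ^ l * card V) \<le> (16 * l) ^ l * x ^ l"
      unfolding xl of_nat_mult using assms(2) by (intro mult_mono) auto
    also have "\<dots> = (16 * l * x) ^ l" by (simp add: power_mult_distrib)
    also have "\<dots> < (48 * l * x) ^ l" using assms(4) x1 by (intro power_strict_mono) auto
    also have "\<dots> \<le> real (\<delta> ^ l)" using \<delta>1 x1 by (simp add: power_mono)
    finally show "(16 * l) ^ l * card V < \<delta> ^ l" by linarith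
  qed
  then have "card (adj_pairs E V) \<le> 2 * (2 * \<delta>) * card V"
    using degenerate_card_adj_pairs[of V E "2 * \<delta>"] assms(1) sym by blast
  then have degs: "(\<Sum>v\<in>V. card (nbhd E V v)) \<le> 4 * \<delta> * card V" using card_adj_pairs[OF assms(1)] by simp
  \<comment> \<open>Cliques through \<open>v\<close> with \<open>v\<close> deleted are cliques in
    the neighbourhood of \<open>v\<close>, whose degeneracy is bounded independently of
    \<open>n\<close>; so their number is linear in the degree of \<open>v\<close>.\<close>
  define M where "M = (\<lambda>v. (\<lambda>f. f - {v}) ` {f\<in>L. v \<in> f})"
  have finL: "finite L" using L(1) assms(1) by (meson finite_Pow_iff finite_subset)
  have M: "card (M v) \<le> 1 + card (nbhd E V v) * 2 ^ (2 * l)" if "v \<in> V" for v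
    by (rule degenerate_card_cliques[OF _ nbhd_degenerate[OF sym irr nocyc that assms(4)]])
       (use assms(1) L in \<open>auto simp: M_def\<close>)
  have "L \<subseteq> {{}} \<union> (\<Union>v\<in>V. insert v ` M v)"
  proof
    fix f assume f: "f \<in> L"
    show "f \<in> {{}} \<union> (\<Union>v\<in>V. insert v ` M v)"
    proof (cases "f = {}")
      case False
      then obtain v where v: "v \<in> f" by blast
      then have "f = insert v (f - {v})" "f - {v} \<in> M v" "v \<in> V" using f L(1) by (auto simp: M_def)
      then show ?thesis by blast
    qed simp
  qed
  then have "card L \<le> card ({{}} \<union> (\<Union>v\<in>V. insert v ` M v))"
    using assms(1) finL by (intro card_mono) (auto simp: M_def)
  also have "\<dots> \<le> 1 + card (\<Union>v\<in>V. insert v ` M v)"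
    using card_Un_le[of "{{}}" "\<Union>v\<in>V. insert v ` M v"] by simp
  also have "card (\<Union>v\<in>V. insert v ` M v) \<le> (\<Sum>v\<in>V. card (insert v ` M v))"
    by (rule card_UN_le[OF assms(1)])
  also have "\<dots> \<le> (\<Sum>v\<in>V. 1 + card (nbhd E V v) * 2 ^ (2 * l))"
    using M finL by (intro sum_mono order_trans[OF card_image_le]) (auto simp: M_def)
  also have "\<dots> = card V + (\<Sum>v\<in>V. card (nbhd E V v)) * 2 ^ (2 * l)"
    unfolding sum.distrib sum_distrib_right by simp
  also have "\<dots> \<le> card V + (4 * \<delta> * card V) * 2 ^ (2 * l)" using degs by simp
  also have "\<dots> \<le> n + (4 * \<delta> * n) * 2 ^ (2 * l)" using assms(2) by (intro add_mono mult_mono) auto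
  also have "(2::nat) ^ (2 * l) = 4 ^ l" by (simp add: power_mult)
  finally have "real (card L) \<le> real (1 + (n + 4 * \<delta> * n * 4 ^ l))" by (simp only: of_nat_le_iff)
  also have "\<dots> = 1 + n + 4 * 4 ^ l * n * real \<delta>" by simp
  also have "\<dots> \<le> n * x + n * x + 4 * 4 ^ l * n * (49 * l * x)"
  proof -
    have "1 \<le> real n * x" using assms(3) x1 mult_mono[of 1 "real n" 1 x] by simp
    moreover have "real n \<le> real n * x" using x1 mult_left_mono[of 1 x "real n"] by simp
    moreover have "4 * 4 ^ l * n * real \<delta> \<le> 4 * 4 ^ l * n * (49 * l * x)"
      by (intro mult_left_mono \<delta>2) auto
    ultimately show ?thesis by linarith
  qed
  \<comment> \<open>196 is 4 times 49; the 2 absorbs the empty clique and the summand 1 for each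
    vertex.\<close>
  also have "\<dots> = (2 + 196 * real l * 4 ^ l) * (n * x)" by (simp add: algebra_simps)
  also have "n * x = real n powr (1 + 1 / l)" using assms(3) by (simp add: x_def powr_add)
  finally show ?thesis by simp
qed

section \<open>Suspended cycles in complexes\<close>

definition contains_suspended_cycle :: "'a set set \<Rightarrow> nat \<Rightarrow> nat \<Rightarrow> bool" where
  "contains_suspended_cycle H k m \<longleftrightarrow>
     (\<exists>T c. finite T \<and> card T = k - 2 \<and> inj_on c {..<m} \<and> T \<inter> c ` {..<m} = {} \<and>
        (\<forall>i<m. T \<union> {c i, c (Suc i mod m)} \<in> H))"

lemma the_inv_into_image_image:
  assumes "inj_on f A" "B \<subseteq> A"
  shows "the_inv_into A f ` f ` B = B"
proof -
  have "the_inv_into A f ` f ` B = (\<lambda>x. x) ` B"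
    unfolding image_image using assms by (intro image_cong refl) (auto simp: the_inv_into_f_f)
  then show ?thesis by simp
qed

text \<open>Since \<open>K\<close> is closed downwards, it contains a copy of the closure as soon as
  it contains the images of the generating edges \<open>S i\<close>. In one direction the inverse of
  the isomorphism embeds these edges; in the other, the image of the whole closure is the required
  subcomplex.\<close>

lemma complex_free_iff:
  assumes K: "abstract_simplicial_complex K" and m: "m > 0"
  shows "complex_free (down_closure (suspension k (cycle_graph m))) K \<longleftrightarrow>
         \<not> contains_suspended_cycle (edges K) k m"
proof -
  define S :: "nat \<Rightarrow> (nat + nat) set" where "S = (\<lambda>i. Inl ` {..<k - 2} \<union> Inr ` {i, Suc i mod m})"
  define F where "F = down_closure (suspension k (cycle_graph m))"
  have vF: "verts F = Inl ` {..<k - 2} \<union> Inr ` {..<m}"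
    by (simp add: F_def down_closure_def suspension_def cycle_graph_def Let_def)
  have eS: "edges (suspension k (cycle_graph m)) = {S i | i. i < m}"
    unfolding suspension_def cycle_graph_def Let_def S_def snd_conv by blast
  have eF: "edges F = {a. \<exists>i<m. a \<subseteq> S i}"
    by (auto simp: F_def down_closure_def eS)
  have Kd: "a \<in> edges K" if "e \<in> edges K" "a \<subseteq> e" for e a
    using K that unfolding abstract_simplicial_complex_def by blast
  have KV: "edges K \<subseteq> Pow (verts K)" using K unfolding abstract_simplicial_complex_def by blast
  have SF: "S i \<subseteq> verts F" if "i < m" for i using that by (auto simp: S_def vF)
  have "(\<exists>G. subcomplex G K \<and> hypergraph_isomorphic G F) \<longleftrightarrow> contains_suspended_cycle (edges K) k m"
  proof
    assume "\<exists>G. subcomplex G K \<and> hypergraph_isomorphic G F"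
    then obtain G f where G: "subcomplex G K" and f: "bij_betw f (verts G) (verts F)"
        "(\<lambda>e. f ` e) ` edges G = edges F"
      by (auto simp: hypergraph_isomorphic_def)
    define h where "h = the_inv_into (verts G) f"
    have h: "inj_on h (verts F)" using bij_betw_the_inv_into[OF f(1)] by (simp add: h_def bij_betw_def)
    have hS: "h ` S i \<in> edges K" if i: "i < m" for i
    proof -
      have "S i \<in> edges F" using i eF by blast
      then obtain e where e: "e \<in> edges G" "S i = f ` e" using f(2) by blast
      have "e \<subseteq> verts G" using e(1) G by (auto simp: subcomplex_def abstract_simplicial_complex_def)
      then have "h ` f ` e = e"
        using f(1) unfolding h_def bij_betw_def by (simp add: the_inv_into_image_image)
      then show ?thesis using e G by (auto simp: subcomplex_def)
    qed
    have "h ` S i = h ` Inl ` {..<k - 2} \<union> {(h \<circ> Inr) i, (h \<circ> Inr) (Suc i mod m)}" for i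
      by (auto simp: S_def)
    moreover have "card (h ` Inl ` {..<k - 2}) = k - 2"
      using inj_on_subset[OF h, of "Inl ` {..<k - 2}"] vF by (simp add: card_image)
    moreover have "inj_on (h \<circ> Inr) {..<m}"
      using inj_on_subset[OF h, of "Inr ` {..<m}"] vF by (intro comp_inj_on) auto
    moreover have "h ` Inl ` {..<k - 2} \<inter> (h \<circ> Inr) ` {..<m} = {}"
      using inj_on_image_Int[OF h, of "Inl ` {..<k - 2}" "Inr ` {..<m}"] vF
      by (auto simp: image_comp[symmetric])
    ultimately show "contains_suspended_cycle (edges K) k m"
      unfolding contains_suspended_cycle_def using hS
      by (intro exI[of _ "h ` Inl ` {..<k - 2}"] exI[of _ "h \<circ> Inr"]) auto
  next
    assume "contains_suspended_cycle (edges K) k m"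
    then obtain T c where T: "finite T" "card T = k - 2" "inj_on c {..<m}" "T \<inter> c ` {..<m} = {}"
        "\<And>i. i < m \<Longrightarrow> T \<union> {c i, c (Suc i mod m)} \<in> edges K"
      by (auto simp: contains_suspended_cycle_def)
    obtain t where t: "bij_betw t {..<k - 2} T"
      using T(1,2) by (metis ex_bij_betw_nat_finite atLeast0LessThan)
    define g where "g = case_sum t c"
    have tT: "t ` {..<k - 2} = T" "inj_on t {..<k - 2}" using t by (auto simp: bij_betw_def)
    have ginj: "inj_on g (verts F)"
    proof -
      have tc: "t i \<noteq> c j" if "i < k - 2" "j < m" for i j using T(4) tT(1) that by blast
      have "inj_on g (Inl ` {..<k - 2})" by (rule inj_on_imageI) (simp add: g_def o_def tT(2))
      moreover have "inj_on g (Inr ` {..<m})" by (rule inj_on_imageI) (simp add: g_def o_def T(3))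
      moreover have "g ` (Inl ` {..<k - 2} - Inr ` {..<m}) \<inter> g ` (Inr ` {..<m} - Inl ` {..<k - 2}) = {}"
        by (auto simp: g_def tc tc[symmetric])
      ultimately show ?thesis unfolding vF inj_on_Un by blast
    qed
    have gS: "g ` S i = T \<union> {c i, c (Suc i mod m)}" for i
      using tT(1) by (simp add: S_def g_def image_Un image_image)
    define G where "G = (g ` verts F, (\<lambda>a. g ` a) ` edges F)"
    have eG: "e \<in> edges G \<longleftrightarrow> (\<exists>i<m. e \<subseteq> g ` S i)" for e
    proof
      assume "\<exists>i<m. e \<subseteq> g ` S i"
      then obtain i where i: "i < m" "e \<subseteq> g ` S i" by blast
      then obtain a where "a \<subseteq> S i" "e = g ` a" by (meson subset_imageE)
      then show "e \<in> edges G" using i by (auto simp: G_def eF)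
    qed (auto simp: G_def eF)
    have "abstract_simplicial_complex G"
      unfolding abstract_simplicial_complex_def
    proof (intro conjI ballI allI impI)
      show "finite (verts G)" by (simp add: G_def vF)
      show "edges G \<subseteq> Pow (verts G)" using SF unfolding G_def fst_conv snd_conv eF by blast
      show "{} \<in> edges G" using m eG by auto
      show "a \<in> edges G" if "e \<in> edges G" "a \<subseteq> e" for e a using that unfolding eG by blast
      fix v assume "v \<in> verts G"
      then obtain u where u: "u \<in> verts F" "v = g u" by (auto simp: G_def)
      then obtain i where "i < m" "u \<in> S i" using m by (auto simp: vF S_def)
      then show "\<exists>e\<in>edges G. v \<in> e" using u eG by blast
    qed
    moreover have eGK: "edges G \<subseteq> edges K"
    proof
      fix e assume "e \<in> edges G"
      then obtain i where "i < m" "e \<subseteq> g ` S i" using eG by blast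
      then show "e \<in> edges K" using T(5)[of i] Kd gS[of i] by simp
    qed
    moreover have "verts G \<subseteq> verts K"
    proof
      fix v assume "v \<in> verts G"
      then obtain e where "e \<in> edges G" "v \<in> e"
        using \<open>abstract_simplicial_complex G\<close> unfolding abstract_simplicial_complex_def by blast
      then show "v \<in> verts K" using eGK KV by blast
    qed
    ultimately have "subcomplex G K" by (simp add: subcomplex_def)
    moreover have "hypergraph_isomorphic G F"
    proof -
      have "bij_betw g (verts F) (verts G)" using ginj by (simp add: bij_betw_def G_def)
      then have 1: "bij_betw (the_inv_into (verts F) g) (verts G) (verts F)" by (rule bij_betw_the_inv_into)
      have "the_inv_into (verts F) g ` g ` a = a" if "a \<in> edges F" for a
      proof -
        have "a \<subseteq> verts F" using that SF unfolding eF by blast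
        then show ?thesis using ginj by (rule the_inv_into_image_image[rotated])
      qed
      then have "(\<lambda>a. the_inv_into (verts F) g ` g ` a) ` edges F = (\<lambda>a. a) ` edges F"
        by (intro image_cong refl)
      then have "(\<lambda>e. the_inv_into (verts F) g ` e) ` edges G = edges F"
        unfolding G_def snd_conv image_image by simp
      then show ?thesis using 1 by (auto simp: hypergraph_isomorphic_def)
    qed
    ultimately show "\<exists>G. subcomplex G K \<and> hypergraph_isomorphic G F" by blast
  qed
  then show ?thesis by (simp add: complex_free_def F_def)
qed

section \<open>The extremal number as a maximum\<close>

lemma finite_ex_complex_set:
  "finite {card (edges K) | K :: nat hypergraph.
     abstract_simplicial_complex K \<and> card (verts K) = n \<and> complex_free F K}"
proof (rule finite_subset)
  show "{card (edges K) | K :: nat hypergraph.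
     abstract_simplicial_complex K \<and> card (verts K) = n \<and> complex_free F K} \<subseteq> {..2 ^ n}"
  proof clarsimp
    fix V :: "nat set" and H assume "abstract_simplicial_complex (V, H)"
    then have "finite V" "H \<subseteq> Pow V" by (auto simp: abstract_simplicial_complex_def)
    then show "card H \<le> 2 ^ card V" using card_mono[of "Pow V" H] by (simp add: card_Pow)
  qed
qed simp

lemma ex_complex_ge:
  fixes K :: "nat hypergraph"
  assumes "abstract_simplicial_complex K" "card (verts K) = n" "complex_free F K"
  shows "card (edges K) \<le> ex_complex n F"
  unfolding ex_complex_def using assms by (intro Max_ge finite_ex_complex_set) blast

lemma ex_complex_witness:
  fixes K :: "nat hypergraph"
  assumes "abstract_simplicial_complex K" "card (verts K) = n" "complex_free F K"
  obtains K' :: "nat hypergraph" where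
    "abstract_simplicial_complex K'" "card (verts K') = n" "complex_free F K'" "card (edges K') = ex_complex n F"
proof -
  have "ex_complex n F \<in> {card (edges K) | K :: nat hypergraph.
     abstract_simplicial_complex K \<and> card (verts K) = n \<and> complex_free F K}"
    unfolding ex_complex_def using assms by (intro Max_in finite_ex_complex_set) blast
  then show ?thesis using that by auto
qed

text \<open>Transfers a \<open>k\<close>-uniform construction to a complex on exactly
  \<open>n\<close> vertices: copy \<open>H\<close> into the naturals, close it downwards, and add
  all singletons so that no vertex is isolated. As \<open>k \<ge> 2\<close>, the
  \<open>k\<close>-element faces are exactly the copies of edges of \<open>H\<close>, and a
  suspended cycle involves only such faces.\<close>

lemma ex_complex_lower:
  assumes H: "\<And>e. e \<in> H \<Longrightarrow> e \<subseteq> U \<and> card e = k" and U: "finite U" "card U \<le> n"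
    and k: "k \<ge> 2" and m: "m \<ge> 2" and free: "\<not> contains_suspended_cycle H k m"
  obtains K :: "nat hypergraph" where "abstract_simplicial_complex K" "card (verts K) = n"
    "complex_free (down_closure (suspension k (cycle_graph m))) K" "card H \<le> card (edges K)"
proof -
  obtain h where h: "h ` U \<subseteq> {..<n}" "inj_on h U"
    using card_le_inj[of U "{..<n}"] U by auto
  define K :: "nat hypergraph" where
    "K = ({..<n}, {a. \<exists>e\<in>H. a \<subseteq> h ` e} \<union> {a. a \<subseteq> {..<n} \<and> card a \<le> 1})"
  have K1: "abstract_simplicial_complex K"
    unfolding abstract_simplicial_complex_def
  proof (intro conjI ballI allI impI)
    show "finite (verts K)" "{} \<in> edges K" by (auto simp: K_def)
    have "a \<subseteq> {..<n}" if "e \<in> H" "a \<subseteq> h ` e" for a e using H[OF that(1)] that(2) h(1) by blast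
    then show "edges K \<subseteq> Pow (verts K)" unfolding K_def by auto
    show "\<exists>e\<in>edges K. v \<in> e" if "v \<in> verts K" for v
      using that by (intro bexI[of _ "{v}"]) (auto simp: K_def)
    show "a \<in> edges K" if e: "e \<in> edges K" "a \<subseteq> e" for e a
    proof -
      have "card a \<le> 1" if "e \<subseteq> {..<n}" "card e \<le> 1"
        using card_mono[of e a] that e(2) finite_subset[OF that(1)] by simp
      then show ?thesis using e unfolding K_def snd_conv by blast
    qed
  qed
  have finH: "finite H" using H U(1) by (meson Pow_iff finite_Pow_iff finite_subset subsetI)
  have eK: "\<exists>e\<in>H. a = h ` e" if a: "a \<in> edges K" "card a = k" for a
  proof -
    obtain e where e: "e \<in> H" "a \<subseteq> h ` e" using a k by (auto simp: K_def)
    have "finite e" using H e U(1) by (meson finite_subset)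
    moreover have "card (h ` e) = k" using H e h(2) by (metis card_image inj_on_subset)
    ultimately show ?thesis using e a by (metis card_subset_eq finite_imageI)
  qed
  have "\<not> contains_suspended_cycle (edges K) k m"
  proof
    assume "contains_suspended_cycle (edges K) k m"
    then obtain T c where T: "finite T" "card T = k - 2" "inj_on c {..<m}" "T \<inter> c ` {..<m} = {}"
        "\<And>i. i < m \<Longrightarrow> T \<union> {c i, c (Suc i mod m)} \<in> edges K"
      by (auto simp: contains_suspended_cycle_def)
    define j where "j = the_inv_into U h"
    have im: "\<exists>e\<in>H. T \<union> {c i, c (Suc i mod m)} = h ` e" if i: "i < m" for i
    proof (rule eK[OF T(5)[OF i]])
      \<comment> \<open>Here \<open>m \<ge> 2\<close> matters: consecutive cycle vertices differ, so
        the face has exactly \<open>k\<close> elements.\<close>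
      have "Suc i mod m < m" "Suc i mod m \<noteq> i" using m i by (auto simp: mod_Suc)
      then have "c i \<noteq> c (Suc i mod m)" using T(3) i by (metis inj_onD lessThan_iff)
      moreover have "T \<inter> {c i, c (Suc i mod m)} = {}" using T(4) i \<open>Suc i mod m < m\<close> by auto
      ultimately show "card (T \<union> {c i, c (Suc i mod m)}) = k"
        using T(1,2) k by (subst card_Un_disjoint) auto
    qed
    have jinj: "inj_on j (h ` U)" using h(2) unfolding j_def by (simp add: inj_on_the_inv_into)
    have sub: "T \<subseteq> h ` U" "c i \<in> h ` U" if i: "i < m" for i
    proof -
      obtain e where "e \<in> H" "T \<union> {c i, c (Suc i mod m)} = h ` e" using im[OF i] by blast
      moreover have "h ` e \<subseteq> h ` U" using H[OF \<open>e \<in> H\<close>] by blast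
      ultimately show "T \<subseteq> h ` U" "c i \<in> h ` U" by blast+
    qed
    have "m > 0" using m by simp
    have "card (j ` T) = k - 2" using T(2) inj_on_subset[OF jinj sub(1)[OF \<open>m > 0\<close>]] by (simp add: card_image)
    moreover have "inj_on (j \<circ> c) {..<m}" using T(3) sub(2)
      by (intro comp_inj_on inj_on_subset[OF jinj]) auto
    moreover have "j ` T \<inter> (j \<circ> c) ` {..<m} = {}"
    proof -
      have "T \<subseteq> h ` U" "c ` {..<m} \<subseteq> h ` U" using sub \<open>m > 0\<close> by blast+
      from inj_on_image_Int[OF jinj this] show ?thesis using T(4) by (simp add: image_comp)
    qed
    moreover have "j ` T \<union> {(j \<circ> c) i, (j \<circ> c) (Suc i mod m)} \<in> H" if i: "i < m" for i
    proof -
      obtain e where e: "e \<in> H" "T \<union> {c i, c (Suc i mod m)} = h ` e" using im i by blast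
      have "j ` T \<union> {(j \<circ> c) i, (j \<circ> c) (Suc i mod m)} = j ` h ` e" unfolding e(2)[symmetric] by auto
      also have "\<dots> = e" using H[OF e(1)] h(2) unfolding j_def by (simp add: the_inv_into_image_image)
      finally show ?thesis using e by simp
    qed
    ultimately have "contains_suspended_cycle H k m"
      unfolding contains_suspended_cycle_def using T(1)
      by (intro exI[of _ "j ` T"] exI[of _ "j \<circ> c"]) auto
    then show False using free by blast
  qed
  then have K2: "complex_free (down_closure (suspension k (cycle_graph m))) K"
    using complex_free_iff[OF K1] m by simp
  have "card H = card ((\<lambda>e. h ` e) ` H)"
    using h(2) H by (intro card_image[symmetric] inj_onI) (metis inj_on_image_eq_iff)
  also have "\<dots> \<le> card (edges K)"
  proof (rule card_mono)
    show "finite (edges K)" using K1 by (auto simp: abstract_simplicial_complex_def intro: finite_subset)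
    show "(\<lambda>e. h ` e) ` H \<subseteq> edges K" by (auto simp: K_def)
  qed
  finally show ?thesis using that K1 K2 by (auto simp: K_def)
qed

section \<open>Counting faces through links\<close>

lemma card_subsets_le:
  assumes "finite V"
  shows "card {S. S \<subseteq> V \<and> card S \<le> j} \<le> (card V + 1) ^ j"
proof (induction j)
  case 0
  have "{S. S \<subseteq> V \<and> card S \<le> 0} = {{}}" using assms by (auto simp: finite_subset)
  then show ?case by simp
next
  case (Suc j)
  let ?A = "{S. S \<subseteq> V \<and> card S \<le> j}"
  have finA: "finite ?A" using assms by simp
  have "{S. S \<subseteq> V \<and> card S \<le> Suc j} \<subseteq> ?A \<union> (\<Union>v\<in>V. insert v ` ?A)"
  proof
    fix S assume S: "S \<in> {S. S \<subseteq> V \<and> card S \<le> Suc j}"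
    show "S \<in> ?A \<union> (\<Union>v\<in>V. insert v ` ?A)"
    proof (cases "S = {}")
      case False
      then obtain v where v: "v \<in> S" by blast
      then have "S = insert v (S - {v})" "S - {v} \<in> ?A" "v \<in> V" using S by auto
      then show ?thesis by blast
    qed simp
  qed
  then have "card {S. S \<subseteq> V \<and> card S \<le> Suc j} \<le> card (?A \<union> (\<Union>v\<in>V. insert v ` ?A))"
    using finA assms by (intro card_mono) auto
  also have "\<dots> \<le> card ?A + card (\<Union>v\<in>V. insert v ` ?A)" by (rule card_Un_le)
  also have "card (\<Union>v\<in>V. insert v ` ?A) \<le> (\<Sum>v\<in>V. card (insert v ` ?A))" by (rule card_UN_le[OF assms])
  also have "\<dots> \<le> (\<Sum>v\<in>V. card ?A)" by (intro sum_mono card_image_le finA)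
  also have "\<dots> = card V * card ?A" by simp
  finally have "card {S. S \<subseteq> V \<and> card S \<le> Suc j} \<le> (card V + 1) * card ?A" by simp
  also have "\<dots> \<le> (card V + 1) * (card V + 1) ^ j" by (intro mult_left_mono Suc.IH) simp
  finally show ?case by simp
qed

lemma card_complex_upper:
  assumes K: "abstract_simplicial_complex K" and n: "card (verts K) = n" "n \<ge> 1"
    and free: "\<not> contains_suspended_cycle (edges K) k (2 * l)" and k: "k \<ge> 2" and l: "l \<ge> 1"
  shows "real (card (edges K)) \<le> (n + 1) ^ (k - 2) * ((2 + 196 * real l * 4 ^ l) * real n powr (1 + 1 / l))"
proof -
  define V where "V = verts K"
  have V: "finite V" "card V = n" and KV: "edges K \<subseteq> Pow V" and Kd: "\<And>a e. e \<in> edges K \<Longrightarrow> a \<subseteq> e \<Longrightarrow> a \<in> edges K"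
    using K n unfolding abstract_simplicial_complex_def V_def by blast+
  \<comment> \<open>For \<open>card S < k - 2\<close> the set \<open>S\<close> accounts for the face
    \<open>S\<close> alone. Every face with at least \<open>k - 2\<close> elements is charged to one
    of its \<open>(k - 2)\<close>-subsets.\<close>
  define Lk where "Lk = (\<lambda>S. if card S = k - 2 then {g. g \<inter> S = {} \<and> g \<union> S \<in> edges K} else {{}})"
  define \<S> where "\<S> = {S. S \<subseteq> V \<and> card S \<le> k - 2}"
  define b where "b = (2 + 196 * real l * 4 ^ l) * real n powr (1 + 1 / l)"
  have fin\<S>: "finite \<S>" using V(1) by (simp add: \<S>_def)
  have Lk_V: "Lk S \<subseteq> Pow V" for S using KV by (auto simp: Lk_def split: if_splits)
  then have finLk: "finite (Lk S)" for S using V(1) by (meson finite_Pow_iff finite_subset)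
  have b: "real (card (Lk S)) \<le> b" if S: "S \<in> \<S>" for S
  proof (cases "card S = k - 2")
    case True
    have finS: "finite S" using S V(1) finite_subset by (auto simp: \<S>_def)
    \<comment> \<open>The graph of the link of \<open>S\<close>: members of \<open>Lk S\<close> are
      cliques in it, and a cycle in it becomes a suspended cycle with \<open>S\<close> as the set of
      added vertices.\<close>
    define E where "E = (\<lambda>u v. u \<noteq> v \<and> u \<notin> S \<and> v \<notin> S \<and> S \<union> {u, v} \<in> edges K)"
    show ?thesis
      unfolding b_def
    proof (rule card_cliques_even_cycle_free[of V n l E])
      show "E u v \<Longrightarrow> E v u" for u v by (auto simp: E_def insert_commute)
      show "E u v" if "f \<in> Lk S" "u \<in> f" "v \<in> f" "u \<noteq> v" for f u v
      proof -
        have f: "f \<inter> S = {}" "f \<union> S \<in> edges K" using that(1) True by (auto simp: Lk_def)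
        have "S \<union> {u, v} \<in> edges K" by (rule Kd[OF f(2)]) (use that in auto)
        then show ?thesis using f that by (auto simp: E_def)
      qed
      show "\<not> contains_cycle E (2 * l) V"
      proof
        assume "contains_cycle E (2 * l) V"
        then obtain xs where xs: "length xs = 2 * l" "distinct xs" "successively E xs" "E (last xs) (hd xs)" "xs \<noteq> []"
          by (auto simp: contains_cycle_def)
        have E: "E (xs ! i) (xs ! (Suc i mod (2 * l)))" if i: "i < 2 * l" for i
        proof (cases "Suc i = 2 * l")
          case True
          then show ?thesis using xs(1,4,5) by (simp add: last_conv_nth hd_conv_nth flip: True)
        next
          case False
          then show ?thesis using xs(1,3) i by (simp add: successively_conv_nth)
        qed
        have "inj_on ((!) xs) {..<2 * l}" using xs(1,2) by (simp add: inj_on_def nth_eq_iff_index_eq)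
        moreover have "S \<inter> (!) xs ` {..<2 * l} = {}" using E by (auto simp: E_def)
        ultimately have "contains_suspended_cycle (edges K) k (2 * l)"
          unfolding contains_suspended_cycle_def using finS True E
          by (intro exI[of _ S] exI[of _ "(!) xs"]) (auto simp: E_def)
        then show False using free by blast
      qed
    qed (use V n(2) l Lk_V in \<open>auto simp: E_def\<close>)
  next
    case False
    have "1 \<le> real n powr (1 + 1 / l)" using n(2) by (simp add: ge_one_powr_ge_zero)
    moreover have "1 \<le> 2 + 196 * real l * 4 ^ l" by simp
    ultimately have "1 * 1 \<le> b" unfolding b_def by (intro mult_mono) auto
    then show ?thesis using False by (simp add: Lk_def)
  qed
  have "edges K \<subseteq> (\<Union>S\<in>\<S>. (\<lambda>g. g \<union> S) ` Lk S)"
  proof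
    fix f assume f: "f \<in> edges K"
    show "f \<in> (\<Union>S\<in>\<S>. (\<lambda>g. g \<union> S) ` Lk S)"
    proof (cases "card f < k - 2")
      case True
      then have "f \<in> \<S>" "{} \<in> Lk f" using f KV by (auto simp: \<S>_def Lk_def)
      then have "f \<in> (\<lambda>g. g \<union> f) ` Lk f" by (intro image_eqI[of _ _ "{}"]) auto
      then show ?thesis using \<open>f \<in> \<S>\<close> by blast
    next
      case False
      obtain S where S: "S \<subseteq> f" "card S = k - 2" "finite S"
        by (rule obtain_subset_with_card_n[of "k - 2" f]) (use False in auto)
      then have "S \<in> \<S>" "f - S \<in> Lk S" "f = (f - S) \<union> S"
        using f KV by (auto simp: \<S>_def Lk_def Un_absorb2)
      then show ?thesis by blast
    qed
  qed
  then have "card (edges K) \<le> card (\<Union>S\<in>\<S>. (\<lambda>g. g \<union> S) ` Lk S)"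
    using fin\<S> finLk by (intro card_mono) auto
  also have "\<dots> \<le> (\<Sum>S\<in>\<S>. card ((\<lambda>g. g \<union> S) ` Lk S))" by (rule card_UN_le[OF fin\<S>])
  also have "\<dots> \<le> (\<Sum>S\<in>\<S>. card (Lk S))" by (intro sum_mono card_image_le finLk)
  finally have "real (card (edges K)) \<le> (\<Sum>S\<in>\<S>. real (card (Lk S)))" by (metis of_nat_le_iff of_nat_sum)
  also have "\<dots> \<le> (\<Sum>S\<in>\<S>. b)" by (intro sum_mono b)
  also have "\<dots> = real (card \<S>) * b" by simp
  also have "\<dots> \<le> real ((n + 1) ^ (k - 2)) * b"
  proof (rule mult_right_mono)
    show "real (card \<S>) \<le> real ((n + 1) ^ (k - 2))"
      using card_subsets_le[OF V(1), of "k - 2"] V(2) unfolding \<S>_def of_nat_le_iff by simp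
    show "0 \<le> b" by (simp add: b_def)
  qed
  finally show ?thesis by (simp add: b_def add.commute)
qed

section \<open>Hypergraphs from products in a group\<close>

context group
begin

primrec gprod :: "(nat \<Rightarrow> 'a) \<Rightarrow> nat \<Rightarrow> 'a" where
  "gprod x 0 = \<one>"
| "gprod x (Suc n) = gprod x n \<otimes> x n"

lemma gprod_closed [simp]: "(\<And>i. i < n \<Longrightarrow> x i \<in> carrier G) \<Longrightarrow> gprod x n \<in> carrier G"
  by (induction n) auto

lemma gprod_cong: "(\<And>i. i < n \<Longrightarrow> x i = y i) \<Longrightarrow> gprod x n = gprod y n"
  by (induction n) auto

lemma gprod_add:
  assumes "\<And>i. i < a + n \<Longrightarrow> x i \<in> carrier G"
  shows "gprod x (a + n) = gprod x a \<otimes> gprod (\<lambda>i. x (a + i)) n"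
  using assms by (induction n) (auto simp: m_assoc)

text \<open>The common factors before position \<open>c\<close> cancel in the quotient; those after
  it form \<open>R\<close> and survive as a conjugation.\<close>

lemma gprod_differ_one:
  assumes c: "c < k" and x: "\<And>i. i < k \<Longrightarrow> x i \<in> carrier G" and y: "\<And>i. i < k \<Longrightarrow> y i \<in> carrier G"
    and eq: "\<And>i. i < k \<Longrightarrow> i \<noteq> c \<Longrightarrow> x i = y i"
  defines "R \<equiv> gprod (\<lambda>i. x (Suc c + i)) (k - Suc c)"
  shows "inv (gprod x k) \<otimes> gprod y k = inv R \<otimes> (inv (x c) \<otimes> y c) \<otimes> R"
proof -
  define P where "P = gprod x c"
  have k: "k = Suc c + (k - Suc c)" using c by simp
  have "gprod x k = gprod x (Suc c) \<otimes> R"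
    unfolding R_def by (subst k, rule gprod_add) (use x c in auto)
  then have gx: "gprod x k = P \<otimes> x c \<otimes> R" by (simp add: P_def)
  have "gprod y k = gprod y (Suc c) \<otimes> gprod (\<lambda>i. y (Suc c + i)) (k - Suc c)"
    by (subst k, rule gprod_add) (use y c in auto)
  moreover have "gprod (\<lambda>i. y (Suc c + i)) (k - Suc c) = R"
    unfolding R_def by (intro gprod_cong) (use eq in auto)
  moreover have "gprod y c = P" unfolding P_def by (intro gprod_cong) (use eq c in auto)
  ultimately have gy: "gprod y k = P \<otimes> y c \<otimes> R" by simp
  have [simp]: "P \<in> carrier G" "R \<in> carrier G" "x c \<in> carrier G" "y c \<in> carrier G"
    using x y c by (auto simp: P_def R_def)
  have "inv P \<otimes> (P \<otimes> (y c \<otimes> R)) = y c \<otimes> R" by (simp flip: m_assoc)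
  then show ?thesis unfolding gx gy by (simp add: inv_mult_group m_assoc)
qed

lemma gprod_telescope:
  assumes "R \<in> carrier G" "\<And>i. w i \<in> carrier G"
  shows "gprod (\<lambda>j. inv R \<otimes> (inv (w j) \<otimes> w (Suc j)) \<otimes> R) n = inv R \<otimes> (inv (w 0) \<otimes> w n) \<otimes> R"
proof (induction n)
  case 0 then show ?case using assms by simp
next
  case (Suc n)
  have 1: "R \<otimes> (inv R \<otimes> z) = z" "w n \<otimes> (inv (w n) \<otimes> z) = z" if "z \<in> carrier G" for z
    using assms that by (simp_all flip: m_assoc)
  show ?case using Suc assms by (simp add: m_assoc 1)
qed

lemma conjugate_quotient_one:
  assumes "R \<in> carrier G" "a \<in> carrier G" "b \<in> carrier G" "inv R \<otimes> (inv a \<otimes> b) \<otimes> R = \<one>"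
  shows "a = b"
proof -
  have "inv R = inv R \<otimes> (inv a \<otimes> b)" using assms by (intro inv_equality) auto
  then have "R \<otimes> inv R = R \<otimes> (inv R \<otimes> (inv a \<otimes> b))" by simp
  also have "\<dots> = (R \<otimes> inv R) \<otimes> (inv a \<otimes> b)"
    by (rule m_assoc[symmetric]) (use assms in auto)
  finally have "inv a \<otimes> b = \<one>" using assms by simp
  then have "inv b = inv a" using assms by (intro inv_equality) auto
  then have "inv (inv b) = inv (inv a)" by simp
  then show ?thesis using assms by simp
qed

definition prod_edges :: "'a set \<Rightarrow> nat \<Rightarrow> (nat \<times> 'a) set set" where
  "prod_edges S k = {(\<lambda>i. (i, x i)) ` {..<k} | x. (\<forall>i<k. x i \<in> carrier G) \<and> gprod x k \<in> S}"

lemma prod_edges_sub: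
  "e \<in> prod_edges S k \<Longrightarrow> e \<subseteq> {..<k} \<times> carrier G \<and> card e = k"
  by (auto simp: prod_edges_def card_image inj_on_def)

text \<open>The first \<open>k - 1\<close> factors and the value of the product in \<open>S\<close>
  can be prescribed freely; they determine the last factor.\<close>

lemma card_prod_edges:
  assumes fin: "finite (carrier G)" and S: "S \<subseteq> carrier G" and k: "k \<ge> 1"
  shows "card (carrier G) ^ (k - 1) * card S \<le> card (prod_edges S k)"
proof -
  define Z where "Z = (PiE {..<k - 1} (\<lambda>_. carrier G)) \<times> S"
  define y where "y = (\<lambda>(x, s) i. if i = k - 1 then inv (gprod x (k - 1)) \<otimes> s else x i)"
  define f where "f = (\<lambda>p. (\<lambda>i. (i, y p i)) ` {..<k})"
  have finS: "finite S" using fin S finite_subset by blast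
  have Suck: "k = Suc (k - 1)" using k by simp
  have yZ: "y p i \<in> carrier G" if "p \<in> Z" "i < k" for p i
    using that S by (auto simp: Z_def y_def PiE_def Pi_def)
  have gy: "gprod (y p) k = snd p" if p: "p \<in> Z" for p
  proof -
    obtain x s where xs: "p = (x, s)" by (cases p)
    have x: "x i \<in> carrier G" if "i < k - 1" for i using p that by (auto simp: xs Z_def PiE_def Pi_def)
    have s: "s \<in> carrier G" using p S by (auto simp: xs Z_def)
    have "gprod (y p) (k - 1) = gprod x (k - 1)" by (intro gprod_cong) (auto simp: y_def xs)
    then have "gprod (y p) k = gprod x (k - 1) \<otimes> (inv (gprod x (k - 1)) \<otimes> s)"
      by (subst Suck) (simp add: y_def xs)
    also have "\<dots> = s" using x s by (simp flip: m_assoc)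
    finally show ?thesis by (simp add: xs)
  qed
  have "inj_on f Z"
  proof (rule inj_onI)
    fix p q assume p: "p \<in> Z" and q: "q \<in> Z" and eq: "f p = f q"
    have y: "y p i = y q i" if "i < k" for i
    proof -
      have "(i, y p i) \<in> f q" using that eq unfolding f_def by blast
      then show ?thesis by (auto simp: f_def)
    qed
    have "fst p i = fst q i" if "i < k - 1" for i
      using y[of i] that by (cases p; cases q) (simp add: y_def)
    then have "fst p = fst q"
      using p q by (intro PiE_ext[of _ "{..<k - 1}" "\<lambda>_. carrier G"]) (auto simp: Z_def)
    moreover have "snd p = snd q" using gy[OF p] gy[OF q] gprod_cong[of k "y p" "y q"] y by simp
    ultimately show "p = q" by (simp add: prod_eq_iff)
  qed
  moreover have "f ` Z \<subseteq> prod_edges S k"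
  proof
    fix e assume "e \<in> f ` Z"
    then obtain p where p: "p \<in> Z" "e = f p" by blast
    have "gprod (y p) k \<in> S"
      unfolding gy[OF p(1)] using p(1) unfolding Z_def by (simp add: mem_Times_iff)
    moreover have "\<forall>i<k. y p i \<in> carrier G" using yZ[OF p(1)] by blast
    ultimately show "e \<in> prod_edges S k" unfolding prod_edges_def p(2) f_def by blast
  qed
  moreover have "finite (prod_edges S k)"
    by (rule finite_subset[of _ "Pow ({..<k} \<times> carrier G)"]) (use prod_edges_sub fin in auto)
  ultimately have "card Z \<le> card (prod_edges S k)" by (rule card_inj_on_le)
  moreover have "card Z = card (carrier G) ^ (k - 1) * card S"
    by (simp add: Z_def card_cartesian_product card_PiE)
  ultimately show ?thesis by simp
qed

text \<open>
  The vertices of the cycle alternate between two of the \<open>k\<close> parts. Starting the cycle in the later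
  part makes consecutive edges \<open>2 j\<close>, \<open>2 j + 1\<close> share the vertex in the earlier part, so that in the
  quotient everything to the left of the later part cancels.
\<close>

lemma prod_edges_no_suspended_cycle:
  assumes k: "k \<ge> 2" and l: "l \<ge> 2"
    and S: "\<And>s. (\<And>i. s i \<in> S) \<Longrightarrow> (\<And>i. s i \<noteq> s (Suc i)) \<Longrightarrow> s (2 * l) = s 0 \<Longrightarrow>
       gprod (\<lambda>j. inv (s (2 * j)) \<otimes> s (Suc (2 * j))) l \<noteq> \<one>"
  shows "\<not> contains_suspended_cycle (prod_edges S k) k (2 * l)"
proof
  assume "contains_suspended_cycle (prod_edges S k) k (2 * l)"
  then obtain T c where T: "finite T" "card T = k - 2" "inj_on c {..<2 * l}" "T \<inter> c ` {..<2 * l} = {}"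
        "\<And>i. i < 2 * l \<Longrightarrow> T \<union> {c i, c (Suc i mod (2 * l))} \<in> prod_edges S k"
    by (auto simp: contains_suspended_cycle_def)
  \<comment> \<open>The cycle is continued periodically, so that indices need no reduction.\<close>
  define c' where "c' = (\<lambda>i. c (i mod (2 * l)))"
  define e where "e = (\<lambda>i. T \<union> {c' i, c' (Suc i)})"
  have l0: "2 * l > 0" using l by simp
  have e: "e i \<in> prod_edges S k" for i
    using T(5)[of "i mod (2 * l)"] l0 by (simp add: e_def c'_def mod_Suc_eq)
  then have "\<forall>i. \<exists>x. e i = (\<lambda>j. (j, x j)) ` {..<k} \<and> (\<forall>j<k. x j \<in> carrier G) \<and> gprod x k \<in> S"
    unfolding prod_edges_def by blast
  then obtain Z where "\<forall>i. e i = (\<lambda>j. (j, Z i j)) ` {..<k} \<and> (\<forall>j<k. Z i j \<in> carrier G) \<and> gprod (Z i) k \<in> S"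
    by metis
  then have Z: "e i = (\<lambda>j. (j, Z i j)) ` {..<k}" "\<And>j. j < k \<Longrightarrow> Z i j \<in> carrier G" "gprod (Z i) k \<in> S" for i
    by blast+
  have inX: "fst u < k \<and> snd u = Z i (fst u)" if "u \<in> e i" for u i using that Z(1) by auto
  have per: "c' (i + 2 * l) = c' i" for i by (simp add: c'_def)
  have cT: "c' i \<notin> T" for i using T(4) l0 by (auto simp: c'_def)
  have cne: "c' i \<noteq> c' (i + d)" if "0 < d" "d < 2 * l" for i d
  proof
    assume "c' i = c' (i + d)"
    then have "i mod (2 * l) = (i + d) mod (2 * l)"
      using T(3) l0 by (auto simp: c'_def dest: inj_onD)
    then have "2 * l dvd d" by (metis add_diff_cancel_left' le_add1 mod_eq_dvd_iff_nat)
    then show False using that by (auto dest: dvd_imp_le)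
  qed
  define f where "f = (\<lambda>i. fst (c' i))"
  define D where "D = {..<k} - fst ` T"
  have ein: "c' i \<in> e i" "c' (Suc i) \<in> e i" "T \<subseteq> e i" for i by (auto simp: e_def)
  have uniq: "u = v" if "u \<in> e i" "v \<in> e i" "fst u = fst v" for u v i
    using inX[OF that(1)] inX[OF that(2)] that(3) by (simp add: prod_eq_iff)
  have fT': "fst v \<notin> fst ` T" if "v \<in> e i" "v \<notin> T" for v i
  proof
    assume "fst v \<in> fst ` T"
    then obtain u where "u \<in> T" "fst u = fst v" by (metis imageE)
    then show False using uniq[of u i v] ein(3)[of i] that by blast
  qed
  have fT: "fst ` T \<inter> {f i, f (Suc i)} = {}" for i
    using fT'[OF ein(1)[of i] cT] fT'[OF ein(2)[of i] cT] by (simp add: f_def)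
  \<comment> \<open>Each edge meets every part once and \<open>T\<close> meets the same
    \<open>k - 2\<close> parts each time, so all cycle vertices lie in the two remaining
    parts.\<close>
  have D: "D = {f i, f (Suc i)}" for i
  proof -
    have "fst ` e i = {..<k}" unfolding Z(1) image_image by simp
    then have "{..<k} = fst ` T \<union> {f i, f (Suc i)}" by (simp add: e_def f_def)
    then show ?thesis using fT[of i] unfolding D_def by blast
  qed
  have fne: "f i \<noteq> f (Suc i)" for i
    using uniq[of "c' i" i "c' (Suc i)"] ein cne[of 1 i] l by (auto simp: f_def)
  have f2: "f (Suc (Suc i)) = f i" for i
    using D[of i] D[of "Suc i"] fne[of i] fne[of "Suc i"] by (auto simp: doubleton_eq_iff)
  define off where "off = (if f 1 < f 0 then 0 else 1 :: nat)"
  have fo: "f (off + 2 * j) = f off" for j by (induction j) (simp_all add: f2)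
  have omax: "f (Suc off) < f off" using fne[of 0] f2[of 0] by (auto simp: off_def)
  have XT: "Z i j = Z i' j" if "j < k" "j \<notin> D" for i i' j
  proof -
    from that obtain u where u: "u \<in> T" "fst u = j" by (auto simp: D_def)
    have "snd u = Z h j" for h using inX[OF subsetD[OF ein(3) u(1)], of h] u(2) by simp
    then show ?thesis by metis
  qed
  have Xc: "Z i (f i) = snd (c' i)" "Z i (f (Suc i)) = snd (c' (Suc i))" "f i < k" for i
    using inX[OF ein(1)[of i]] inX[OF ein(2)[of i]] by (auto simp: f_def)
  have Xstep: "Z i j = Z (Suc i) j" if "j < k" "j \<noteq> f i" for i j
  proof (cases "j \<in> D")
    case True
    then have "j = f (Suc i)" using D[of i] that by blast
    then show ?thesis using Xc(2)[of i] Xc(1)[of "Suc i"] by simp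
  qed (use XT that in blast)
  define s where "s = (\<lambda>i. gprod (Z (off + i)) k)"
  define Rr where "Rr = (\<lambda>i. gprod (\<lambda>j. Z i (Suc (f i) + j)) (k - Suc (f i)))"
  have RrC: "Rr i \<in> carrier G" for i unfolding Rr_def by (intro gprod_closed Z(2)) auto
  have sstep: "inv (gprod (Z i) k) \<otimes> gprod (Z (Suc i)) k =
      inv (Rr i) \<otimes> (inv (snd (c' i)) \<otimes> snd (c' (Suc (Suc i)))) \<otimes> Rr i" for i
  proof -
    have "Z (Suc i) (f i) = snd (c' (Suc (Suc i)))" using Xc(2)[of "Suc i"] f2[of i] by simp
    then show ?thesis
      using gprod_differ_one[of "f i" k "Z i" "Z (Suc i)"] Z(2) Xc[of i] Xstep unfolding Rr_def by simp
  qed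
  have cC: "snd (c' i) \<in> carrier G" for i using Xc[of i] Z(2)[of "f i" i] by simp
  have "gprod (\<lambda>j. inv (s (2 * j)) \<otimes> s (Suc (2 * j))) l \<noteq> \<one>"
  proof (rule S)
    show "s i \<in> S" for i using Z(3) by (simp add: s_def)
    show "s (2 * l) = s 0"
    proof -
      have "e (off + 2 * l) = e off" using per[of off] per[of "Suc off"] by (simp add: e_def)
      then have "Z (off + 2 * l) j = Z off j" if "j < k" for j
        using Z(1)[of "off + 2 * l"] Z(1)[of off] that by auto
      then show ?thesis unfolding s_def add_0_right by (rule gprod_cong)
    qed
    \<comment> \<open>Equal products would force two cycle vertices at distance 2 to coincide, but
      \<open>2 < 2 * l\<close>.\<close>
    show "s i \<noteq> s (Suc i)" for i
    proof
      let ?i = "off + i"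
      assume "s i = s (Suc i)"
      then have "inv (gprod (Z ?i) k) \<otimes> gprod (Z (Suc ?i)) k = \<one>"
        using Z(2) by (simp add: s_def)
      then have "inv (Rr ?i) \<otimes> (inv (snd (c' ?i)) \<otimes> snd (c' (Suc (Suc ?i)))) \<otimes> Rr ?i = \<one>"
        using sstep by simp
      then have "snd (c' ?i) = snd (c' (Suc (Suc ?i)))"
        by (rule conjugate_quotient_one[OF RrC cC cC])
      then have "c' ?i = c' (?i + 2)" using f2[of ?i] by (simp add: f_def prod_eq_iff)
      then show False using cne[of 2 ?i] l by simp
    qed
  qed
  \<comment> \<open>Behind the later of the two parts all coordinates come from \<open>T\<close>, so
    the conjugating element is the same for every \<open>j\<close> and the product
    telescopes.\<close>
  moreover have "Rr (off + 2 * j) = Rr off" for j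
  proof -
    have "Z (off + 2 * j) (Suc (f off) + i) = Z off (Suc (f off) + i)" if "i < k - Suc (f off)" for i
      by (rule XT) (use that D[of off] omax in auto)
    then show ?thesis unfolding Rr_def fo by (intro gprod_cong) auto
  qed
  then have "inv (s (2 * j)) \<otimes> s (Suc (2 * j)) =
      inv (Rr off) \<otimes> (inv (snd (c' (off + 2 * j))) \<otimes> snd (c' (off + 2 * Suc j))) \<otimes> Rr off" for j
    using sstep[of "off + 2 * j"] by (simp add: s_def)
  then have "gprod (\<lambda>j. inv (s (2 * j)) \<otimes> s (Suc (2 * j))) l =
      inv (Rr off) \<otimes> (inv (snd (c' (off + 2 * 0))) \<otimes> snd (c' (off + 2 * l))) \<otimes> Rr off"
    using gprod_telescope[of "Rr off" "\<lambda>j. snd (c' (off + 2 * j))" l] RrC cC by simp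
  then have "gprod (\<lambda>j. inv (s (2 * j)) \<otimes> s (Suc (2 * j))) l = \<one>"
    using per[of off] RrC cC by simp
  ultimately show False by blast
qed

end

section \<open>The group acting on the moment curve\<close>

text \<open>The matrix of \<open>A\<^sub>t\<close>, chosen such that \<open>A\<^sub>t m(x) = m(x + t)\<close> by the binomial theorem.\<close>

definition shift :: "'a::comm_ring_1 \<Rightarrow> (nat \<Rightarrow> 'a) \<Rightarrow> nat \<Rightarrow> 'a" where
  "shift t w i = (\<Sum>r\<le>i. of_nat (i choose r) * t ^ (i - r) * w r)"

lemma shift_cong: "(\<And>r. r \<le> i \<Longrightarrow> v r = w r) \<Longrightarrow> shift t v i = shift t w i"
  unfolding shift_def by (intro sum.cong) auto

lemma shift_at_0 [simp]: "shift t w 0 = w 0"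
  by (simp add: shift_def)

lemma shift_0 [simp]: "shift 0 w i = w i"
proof -
  have "shift 0 w i = (\<Sum>r\<le>i. if r = i then w r else 0)"
    unfolding shift_def by (intro sum.cong) (auto simp: power_0_left)
  then show ?thesis by simp
qed

lemma shift_add: "shift t (\<lambda>i. v i + w i) i = shift t v i + shift t w i"
  by (simp add: shift_def algebra_simps sum.distrib)

lemma shift_moment: "shift t (\<lambda>r. c * x ^ r) i = c * (x + t) ^ i"
  unfolding binomial_ring shift_def sum_distrib_left by (intro sum.cong) (auto simp: mult_ac)

text \<open>Matrix form of applying the translations by \<open>t\<close> and \<open>s\<close> in
  succession: \<open>choose_mult\<close> followed by the binomial theorem for
  \<open>(t + s) ^ (i - u)\<close>. It yields associativity in \<open>curve_group\<close>.\<close>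

lemma shift_shift: "shift s (shift t w) i = shift (s + t) w i"
proof -
  have "shift s (shift t w) i =
      (\<Sum>r\<le>i. \<Sum>u\<le>r. of_nat (i choose r) * s ^ (i - r) * (of_nat (r choose u) * t ^ (r - u) * w u))"
    by (simp add: shift_def sum_distrib_left)
  also have "\<dots> = (\<Sum>r\<le>i. \<Sum>u\<le>i. of_nat (i choose r) * s ^ (i - r) * (of_nat (r choose u) * t ^ (r - u) * w u))"
    by (intro sum.cong refl sum.mono_neutral_left) (auto simp: binomial_eq_0)
  also have "\<dots> = (\<Sum>u\<le>i. \<Sum>r\<le>i. of_nat (i choose r) * s ^ (i - r) * (of_nat (r choose u) * t ^ (r - u) * w u))"
    by (rule sum.swap)
  also have "\<dots> = (\<Sum>u\<le>i. of_nat (i choose u) * (s + t) ^ (i - u) * w u)"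
  proof (intro sum.cong refl)
    fix u assume "u \<in> {..i}"
    then have u: "u \<le> i" by simp
    have "(\<Sum>r\<le>i. of_nat (i choose r) * s ^ (i - r) * (of_nat (r choose u) * t ^ (r - u) * w u)) =
        (\<Sum>r\<in>{u..i}. of_nat (i choose r) * s ^ (i - r) * (of_nat (r choose u) * t ^ (r - u) * w u))"
      by (intro sum.mono_neutral_right) (auto simp: binomial_eq_0)
    also have "\<dots> = (\<Sum>q\<le>i - u. of_nat (i choose (q + u)) * s ^ (i - (q + u)) * (of_nat ((q + u) choose u) * t ^ q * w u))"
      by (rule sum.reindex_bij_witness[of _ "\<lambda>q. q + u" "\<lambda>r. r - u"]) (use u in auto)
    also have "\<dots> = (\<Sum>q\<le>i - u. of_nat (i choose u) * w u * (of_nat ((i - u) choose q) * t ^ q * s ^ (i - u - q)))"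
    proof (intro sum.cong refl)
      fix q assume "q \<in> {..i - u}"
      then have "(i choose (q + u)) * ((q + u) choose u) = (i choose u) * ((i - u) choose q)"
        using choose_mult[of u "q + u" i] u by simp
      then have eq: "of_nat (i choose (q + u)) * of_nat ((q + u) choose u) = (of_nat (i choose u) * of_nat ((i - u) choose q) :: 'a)"
        by (metis of_nat_mult)
      have "of_nat (i choose (q + u)) * s ^ (i - (q + u)) * (of_nat ((q + u) choose u) * t ^ q * w u) =
          (of_nat (i choose (q + u)) * of_nat ((q + u) choose u)) * (s ^ (i - (q + u)) * t ^ q * w u)"
        by (simp only: mult_ac)
      also have "\<dots> = of_nat (i choose u) * w u * (of_nat ((i - u) choose q) * t ^ q * s ^ (i - (q + u)))"
        unfolding eq by (simp only: mult_ac)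
      finally have *: "of_nat (i choose (q + u)) * s ^ (i - (q + u)) * (of_nat ((q + u) choose u) * t ^ q * w u) =
          of_nat (i choose u) * w u * (of_nat ((i - u) choose q) * t ^ q * s ^ (i - (q + u)))" .
      have "i - (q + u) = i - u - q" by simp
      from *[unfolded this] show "of_nat (i choose (q + u)) * s ^ (i - (q + u)) * (of_nat ((q + u) choose u) * t ^ q * w u) =
          of_nat (i choose u) * w u * (of_nat ((i - u) choose q) * t ^ q * s ^ (i - u - q))"
        unfolding \<open>i - (q + u) = i - u - q\<close> .
    qed
    also have "\<dots> = of_nat (i choose u) * w u * (t + s) ^ (i - u)"
      unfolding binomial_ring sum_distrib_left by simp
    finally show "(\<Sum>r\<le>i. of_nat (i choose r) * s ^ (i - r) * (of_nat (r choose u) * t ^ (r - u) * w u)) =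
        of_nat (i choose u) * (s + t) ^ (i - u) * w u"
      by (simp add: mult_ac add.commute)
  qed
  finally show ?thesis by (simp only: shift_def)
qed

text \<open>A predicate on sets, because the field with \<open>2 ^ m\<close> elements will be a
  subset of one fixed type, the algebraic closure of \<open>bit\<close>, for all
  \<open>m\<close>.\<close>

definition is_subring :: "'a::comm_ring_1 set \<Rightarrow> bool" where
  "is_subring F \<longleftrightarrow> 0 \<in> F \<and> 1 \<in> F \<and> (\<forall>x\<in>F. \<forall>y\<in>F. x + y \<in> F \<and> x * y \<in> F) \<and> (\<forall>x\<in>F. - x \<in> F)"

lemma is_subring_power: "is_subring F \<Longrightarrow> x \<in> F \<Longrightarrow> x ^ n \<in> F"
  by (induction n) (auto simp: is_subring_def)

lemma is_subring_of_nat: "is_subring F \<Longrightarrow> of_nat n \<in> F"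
  by (induction n) (auto simp: is_subring_def)

lemma is_subring_sum: "is_subring F \<Longrightarrow> (\<And>x. x \<in> A \<Longrightarrow> f x \<in> F) \<Longrightarrow> sum f A \<in> F"
  by (induction A rule: infinite_finite_induct) (auto simp: is_subring_def)

lemma is_subring_shift:
  assumes F: "is_subring F" and "t \<in> F" "\<And>r. r \<le> i \<Longrightarrow> w r \<in> F"
  shows "shift t w i \<in> F"
  unfolding shift_def
proof (rule is_subring_sum[OF F])
  fix r assume "r \<in> {..i}"
  then have "of_nat (i choose r) \<in> F" "t ^ (i - r) \<in> F" "w r \<in> F"
    using is_subring_of_nat[OF F] is_subring_power[OF F assms(2)] assms(3) by auto
  then show "of_nat (i choose r) * t ^ (i - r) * w r \<in> F" using F unfolding is_subring_def by blast
qed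

text \<open>Vectors of length \<open>l\<close> are functions that vanish from \<open>l\<close> on,
  so that equality of vectors is equality of functions.\<close>

definition curve_group :: "nat \<Rightarrow> 'a::comm_ring_1 set \<Rightarrow> (nat \<Rightarrow> 'a) monoid" where
  "curve_group l F = \<lparr>carrier = {v. (\<forall>i<l. v i \<in> F) \<and> (\<forall>i\<ge>l. v i = 0)},
     monoid.mult = (\<lambda>v w i. if i < l then v i + shift (v 0) w i else 0), monoid.one = (\<lambda>_. 0)\<rparr>"

lemma curve_group_simps:
  "v \<in> carrier (curve_group l F) \<longleftrightarrow> (\<forall>i<l. v i \<in> F) \<and> (\<forall>i\<ge>l. v i = 0)"
  "v \<otimes>\<^bsub>curve_group l F\<^esub> w = (\<lambda>i. if i < l then v i + shift (v 0) w i else 0)"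
  "\<one>\<^bsub>curve_group l F\<^esub> = (\<lambda>_. 0)"
  by (simp_all add: curve_group_def)

lemma group_curve_group:
  assumes F: "is_subring F"
  shows "group (curve_group l F)"
proof (rule groupI)
  have Fadd: "x + y \<in> F" if "x \<in> F" "y \<in> F" for x y using F that by (simp add: is_subring_def)
  have F0: "0 \<in> F" using F by (simp add: is_subring_def)
  fix v w assume v: "v \<in> carrier (curve_group l F)" and w: "w \<in> carrier (curve_group l F)"
  have "v 0 \<in> F" using v F0 by (cases "0 < l") (auto simp: curve_group_simps)
  then have "shift (v 0) w i \<in> F" if "i < l" for i
    using w that by (intro is_subring_shift[OF F]) (auto simp: curve_group_simps)
  then show "v \<otimes>\<^bsub>curve_group l F\<^esub> w \<in> carrier (curve_group l F)"
    using v by (auto simp: curve_group_simps intro: Fadd)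
  fix z assume z: "z \<in> carrier (curve_group l F)"
  show "v \<otimes>\<^bsub>curve_group l F\<^esub> w \<otimes>\<^bsub>curve_group l F\<^esub> z = v \<otimes>\<^bsub>curve_group l F\<^esub> (w \<otimes>\<^bsub>curve_group l F\<^esub> z)"
  proof
    fix i
    show "(v \<otimes>\<^bsub>curve_group l F\<^esub> w \<otimes>\<^bsub>curve_group l F\<^esub> z) i = (v \<otimes>\<^bsub>curve_group l F\<^esub> (w \<otimes>\<^bsub>curve_group l F\<^esub> z)) i"
    proof (cases "i < l")
      case True
      have "shift (v 0) (\<lambda>i. if i < l then w i + shift (w 0) z i else 0) i = shift (v 0) (\<lambda>i. w i + shift (w 0) z i) i"
        using True by (intro shift_cong) auto
      also have "\<dots> = shift (v 0) w i + shift (v 0 + w 0) z i"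
        unfolding shift_add by (simp only: shift_shift)
      finally show ?thesis using True by (simp add: curve_group_simps add.assoc)
    qed (simp add: curve_group_simps)
  qed
next
  show "\<one>\<^bsub>curve_group l F\<^esub> \<in> carrier (curve_group l F)"
    using F by (simp add: curve_group_simps is_subring_def)
next
  fix v assume v: "v \<in> carrier (curve_group l F)"
  have F0: "0 \<in> F" "\<And>x. x \<in> F \<Longrightarrow> - x \<in> F" using F by (simp_all add: is_subring_def)
  have v0: "v 0 \<in> F" using v F0 by (cases "0 < l") (auto simp: curve_group_simps)
  show "\<one>\<^bsub>curve_group l F\<^esub> \<otimes>\<^bsub>curve_group l F\<^esub> v = v"
    using v by (auto simp: curve_group_simps)
  \<comment> \<open>Its coordinate 0 is \<open>- v 0\<close>, so multiplying \<open>v\<close> by it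
    from the left adds \<open>shift (- v 0) v\<close> and cancels.\<close>
  define w where "w = (\<lambda>i. if i < l then - shift (- v 0) v i else 0)"
  have "shift (- v 0) v i \<in> F" if "i < l" for i
    using v that v0 F0 by (intro is_subring_shift[OF F]) (auto simp: curve_group_simps)
  then have "w \<in> carrier (curve_group l F)" using F0 by (auto simp: curve_group_simps w_def)
  moreover have "w \<otimes>\<^bsub>curve_group l F\<^esub> v = \<one>\<^bsub>curve_group l F\<^esub>"
    by (rule ext) (auto simp: curve_group_simps w_def)
  ultimately show "\<exists>w\<in>carrier (curve_group l F). w \<otimes>\<^bsub>curve_group l F\<^esub> v = \<one>\<^bsub>curve_group l F\<^esub>" by blast
qed

lemma card_curve_group:
  assumes "finite F"
  shows "finite (carrier (curve_group l F))" "card (carrier (curve_group l F)) = card F ^ l"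
proof -
  define h :: "(nat \<Rightarrow> 'a) \<Rightarrow> nat \<Rightarrow> 'a" where "h = (\<lambda>v i. if i < l then v i else 0)"
  have "bij_betw h (PiE {..<l} (\<lambda>_. F)) (carrier (curve_group l F))"
    by (rule bij_betw_byWitness[where f' = "\<lambda>v. restrict v {..<l}"])
       (auto simp: h_def curve_group_simps fun_eq_iff PiE_def extensional_def Pi_def)
  then show "finite (carrier (curve_group l F))" "card (carrier (curve_group l F)) = card F ^ l"
    using assms by (auto simp: bij_betw_finite[symmetric] bij_betw_same_card[symmetric] card_PiE intro: finite_PiE)
qed

text \<open>The polynomial \<open>f\<close> that vanishes at all \<open>y j\<close> with
  \<open>j \<noteq> a\<close> has degree below \<open>l\<close>, so the sum of
  \<open>\<tau> j * poly f (y j)\<close> is a combination of the vanishing moments. Only the term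
  for \<open>a\<close> remains, so \<open>y a\<close> is a root of \<open>f\<close>.\<close>

lemma repeated_of_moments_zero:
  fixes \<tau> y :: "nat \<Rightarrow> 'a::field"
  assumes mom: "\<And>i. i < l \<Longrightarrow> (\<Sum>j<l. \<tau> j * y j ^ i) = 0" and ne: "\<tau> a \<noteq> 0" and a: "a < l"
  shows "\<exists>j<l. j \<noteq> a \<and> y j = y a"
proof (rule ccontr)
  assume neg: "\<not> ?thesis"
  define Z where "Z = y ` ({..<l} - {a})"
  define f where "f = (\<Prod>z\<in>Z. [:- z, 1:])"
  have pf: "poly f x = (\<Prod>z\<in>Z. x - z)" for x by (simp add: f_def poly_prod)
  have "card Z \<le> l - 1" using card_image_le[of "{..<l} - {a}" y] a by (simp add: Z_def)
  moreover have "Polynomial.degree f = card Z" unfolding f_def by (subst degree_prod_sum_eq) auto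
  ultimately have deg: "Polynomial.degree f < l" using a by linarith
  have "(\<Sum>j<l. \<tau> j * poly f (y j)) = (\<Sum>j<l. \<Sum>i\<le>Polynomial.degree f. Polynomial.coeff f i * (\<tau> j * y j ^ i))"
    unfolding poly_altdef sum_distrib_left by (intro sum.cong refl) (simp add: mult_ac)
  also have "\<dots> = (\<Sum>i\<le>Polynomial.degree f. Polynomial.coeff f i * (\<Sum>j<l. \<tau> j * y j ^ i))"
    unfolding sum_distrib_left by (rule sum.swap)
  also have "\<dots> = 0" using deg mom by (intro sum.neutral) auto
  finally have 0: "(\<Sum>j<l. \<tau> j * poly f (y j)) = 0" .
  have "poly f (y j) = 0" if "j < l" "j \<noteq> a" for j
    unfolding pf by (rule prod_zero) (use that in \<open>auto simp: Z_def\<close>)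
  then have "(\<Sum>j\<in>{..<l} - {a}. \<tau> j * poly f (y j)) = 0" by (intro sum.neutral) auto
  then have "\<tau> a * poly f (y a) = 0" using 0 a by (simp add: sum.remove[of "{..<l}" a])
  then have "poly f (y a) = 0" using ne by simp
  then have "y a \<in> Z" unfolding pf by (auto simp: Z_def)
  then show False using neg by (auto simp: Z_def)
qed

text \<open>Otherwise every value is repeated, at cyclically non-adjacent positions. For
  \<open>l = 3\<close> all positions are adjacent. For \<open>l = 5\<close> no three positions are
  pairwise non-adjacent, so equal values would pair off an odd number of positions. For
  \<open>l = 7\<close> the argument fails: a, b, a, b, c, a, c is possible.\<close>

lemma closed_walk_moments_nonzero:
  fixes \<tau> y :: "nat \<Rightarrow> 'a::field"
  assumes l: "l \<in> {3, 5}" and "\<And>j. \<tau> j \<noteq> 0" "\<And>j. y j \<noteq> y (Suc j)" "y l = y 0"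
  shows "\<exists>i<l. (\<Sum>j<l. \<tau> j * y j ^ i) \<noteq> 0"
proof (rule ccontr)
  assume "\<not> ?thesis"
  then have rep: "\<exists>j<l. j \<noteq> a \<and> y j = y a" if "a < l" for a
    using repeated_of_moments_zero[of l \<tau> y a] assms(2) that by blast
  note n = assms(3)[of 0] assms(3)[of 1] assms(3)[of 2] assms(3)[of 3] assms(3)[of 4]
  from l consider "l = 3" | "l = 5" by auto
  then show False
  proof cases
    case 1
    have "y 0 \<noteq> y 1" "y 1 \<noteq> y 2" "y 2 \<noteq> y 0" using n assms(4) 1 by (simp_all add: numeral_eq_Suc)
    moreover have "\<exists>j\<in>{0, 1, 2}. j \<noteq> 0 \<and> y j = y 0"
      using rep[of 0] 1 by (auto simp: less_Suc_eq numeral_eq_Suc)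
    ultimately show False by auto
  next
    case 2
    have y: "y 0 \<noteq> y 1" "y 1 \<noteq> y 2" "y 2 \<noteq> y 3" "y 3 \<noteq> y 4" "y 4 \<noteq> y 0"
      using n assms(4) 2 by (simp_all add: numeral_eq_Suc)
    have r: "\<exists>j\<in>{0, 1, 2, 3, 4}. j \<noteq> a \<and> y j = y a" if "a \<in> {0, 1, 2, 3, 4}" for a
    proof -
      have "a < l" using that 2 by auto
      then obtain j where "j < 5" "j \<noteq> a" "y j = y a" using rep 2 by blast
      moreover have "j \<in> {0, 1, 2, 3, 4}" using \<open>j < 5\<close> by auto
      ultimately show ?thesis by blast
    qed
    have "y 2 = y 0 \<or> y 3 = y 0" using r[of 0] y by auto
    moreover have "y 3 = y 1 \<or> y 4 = y 1" using r[of 1] y by auto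
    moreover have "y 4 = y 2 \<or> y 0 = y 2" using r[of 2] y by auto
    moreover have "y 0 = y 3 \<or> y 1 = y 3" using r[of 3] y by auto
    moreover have "y 1 = y 4 \<or> y 2 = y 4" using r[of 4] y by auto
    ultimately show False using y by metis
  qed
qed

definition base_point :: "'a::zero \<Rightarrow> nat \<Rightarrow> 'a" where
  "base_point c = (\<lambda>i. if i = 0 then c else 0)"

lemma curve_group_no_closed_walk:
  fixes F :: "'a::field set"
  assumes F: "is_subring F" and l: "l \<in> {3, 5}"
    and s: "\<And>i. s i \<in> base_point ` F" "\<And>i. s i \<noteq> s (Suc i)" "s (2 * l) = s 0"
  shows "group.gprod (curve_group l F) (\<lambda>j. inv\<^bsub>curve_group l F\<^esub> s (2 * j) \<otimes>\<^bsub>curve_group l F\<^esub> s (Suc (2 * j))) l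
     \<noteq> \<one>\<^bsub>curve_group l F\<^esub>"
proof
  interpret group "curve_group l F" by (rule group_curve_group[OF F])
  have l0: "0 < l" using l by auto
  have Fm: "\<And>x y. x \<in> F \<Longrightarrow> y \<in> F \<Longrightarrow> x - y \<in> F" "\<And>x. x \<in> F \<Longrightarrow> - x \<in> F" "0 \<in> F"
      "\<And>x y. x \<in> F \<Longrightarrow> y \<in> F \<Longrightarrow> x * y \<in> F"
    using F unfolding is_subring_def by (metis diff_conv_add_uminus)+
  assume eq: "gprod (\<lambda>j. inv\<^bsub>curve_group l F\<^esub> s (2 * j) \<otimes>\<^bsub>curve_group l F\<^esub> s (Suc (2 * j))) l = \<one>\<^bsub>curve_group l F\<^esub>"
  define c where "c = (\<lambda>i. s i 0)"
  have sc: "s i = base_point (c i)" "c i \<in> F" for i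
    using s(1)[of i] by (auto simp: c_def base_point_def)
  have cne: "c i \<noteq> c (Suc i)" for i using s(2)[of i] sc(1)[of i] sc(1)[of "Suc i"] by auto
  have c0: "c (2 * l) = c 0" using s(3) by (simp add: c_def)
  define \<tau> where "\<tau> = (\<lambda>j. c (Suc (2 * j)) - c (2 * j))"
  define v where "v = (\<lambda>t x i. if i < l then t * x ^ i else (0 :: 'a))"
  define x where "x = (\<lambda>j. - c (2 * j))"
  define T where "T = (\<lambda>n. \<Sum>j<n. \<tau> j)"
  have vC: "v t z \<in> carrier (curve_group l F)" if "t \<in> F" "z \<in> F" for t z
    using that Fm is_subring_power[OF F] by (auto simp: curve_group_simps v_def)
  have bC: "base_point t \<in> carrier (curve_group l F)" if "t \<in> F" for t
    using that Fm l0 by (auto simp: curve_group_simps base_point_def)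
  \<comment> \<open>Solves \<open>s (2 * j) \<otimes> z = s (Suc (2 * j))\<close> for
    \<open>z\<close>: left multiplication by a base point \<open>c\<close> translates the curve
    parameter by \<open>c\<close>, so a point with parameter \<open>- c\<close> is moved to a
    multiple of the first unit vector.\<close>
  have step: "inv\<^bsub>curve_group l F\<^esub> s (2 * j) \<otimes>\<^bsub>curve_group l F\<^esub> s (Suc (2 * j)) = v (\<tau> j) (x j)" for j
  proof -
    have "base_point (c (2 * j)) \<otimes>\<^bsub>curve_group l F\<^esub> v (\<tau> j) (x j) = base_point (c (Suc (2 * j)))"
    proof
      fix i
      have "shift (c (2 * j)) (v (\<tau> j) (x j)) i = \<tau> j * (x j + c (2 * j)) ^ i" if "i < l"
        unfolding shift_moment[symmetric] using that by (intro shift_cong) (simp add: v_def)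
      then show "(base_point (c (2 * j)) \<otimes>\<^bsub>curve_group l F\<^esub> v (\<tau> j) (x j)) i = base_point (c (Suc (2 * j))) i"
        using l0 by (auto simp: curve_group_simps base_point_def x_def \<tau>_def)
    qed
    moreover have "\<tau> j \<in> F" "x j \<in> F" using Fm sc(2) by (auto simp: \<tau>_def x_def)
    ultimately show ?thesis
      using vC bC[OF sc(2)] sc(1) by (metis inv_solve_left)
  qed
  \<comment> \<open>The partial product has coordinate 0 equal to \<open>T n\<close>, and this is
    the amount by which the next curve parameter is translated.\<close>
  have val: "gprod (\<lambda>j. v (\<tau> j) (x j)) n i = (\<Sum>j<n. \<tau> j * (x j + T j) ^ i)" if "i < l" for n i
    using that
  proof (induction n arbitrary: i)
    case 0
    then show ?case by (simp add: curve_group_simps)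
  next
    case (Suc n)
    have g0: "gprod (\<lambda>j. v (\<tau> j) (x j)) n 0 = T n" using Suc.IH[OF l0] by (simp add: T_def)
    have "shift (T n) (v (\<tau> n) (x n)) i = \<tau> n * (x n + T n) ^ i"
      unfolding shift_moment[symmetric] using Suc.prems by (intro shift_cong) (simp add: v_def)
    then show ?case using Suc.IH[OF Suc.prems] Suc.prems g0 by (simp add: curve_group_simps)
  qed
  have zero: "(\<Sum>j<l. \<tau> j * (x j + T j) ^ i) = 0" if "i < l" for i
    using val[OF that, of l] eq unfolding step by (simp add: curve_group_simps)
  \<comment> \<open>The zeroth moment closes the walk of the parameters
    \<open>x j + T j\<close>.\<close>
  then have Tl: "T l = 0" using zero[OF l0] by (simp add: T_def)
  have "\<exists>i<l. (\<Sum>j<l. \<tau> j * (x j + T j) ^ i) \<noteq> 0"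
  proof (rule closed_walk_moments_nonzero[OF l])
    show "\<tau> j \<noteq> 0" for j using cne[of "2 * j"] by (simp add: \<tau>_def)
    \<comment> \<open>The difference of the two sides is
      \<open>c (2 * j + 2) - c (2 * j + 1)\<close>: the even steps of \<open>s\<close> give the
      weights \<open>\<tau>\<close>, the odd steps separate the parameters.\<close>
    show "x j + T j \<noteq> x (Suc j) + T (Suc j)" for j
      using cne[of "Suc (2 * j)"] by (simp add: x_def T_def \<tau>_def)
    show "x l + T l = x 0 + T 0" using Tl c0 by (simp add: x_def T_def)
  qed
  then show False using zero by blast
qed

section \<open>Finite fields of characteristic two\<close>

lemma CHAR_bit: "CHAR(bit) = 2"
proof -
  have "(of_nat 2 :: bit) = 0" by simp
  then have "CHAR(bit) dvd 2" unfolding of_nat_eq_0_iff_char_dvd .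
  moreover have "CHAR(bit) \<noteq> 1" by simp
  ultimately show ?thesis by (metis prime_nat_iff two_is_prime_nat)
qed

text \<open>
  Prime powers \<open>2\<^sup>m\<close> are dense enough for the order of magnitude, so no information on the
  distribution of primes is needed.
\<close>

lemma finite_subfield_exists:
  assumes m: "m \<ge> 1"
  shows "\<exists>F :: bit alg_closure set. is_subring F \<and> finite F \<and> card F = 2 ^ m"
proof -
  define q :: nat where "q = 2 ^ m"
  have q2: "q \<ge> 2" using m by (cases m) (auto simp: q_def)
  have ch: "CHAR(bit alg_closure) = 2" by (simp add: CHAR_bit)
  \<comment> \<open>The fixed points of a power of the Frobenius map, which is additive in
    characteristic 2.\<close>
  define F where "F = {x :: bit alg_closure. x ^ q = x}"
  have add: "(x + y) ^ q = x ^ q + y ^ q" for x y :: "bit alg_closure"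
    by (rule freshmans_dream') (use ch in \<open>auto simp: q_def\<close>)
  have "(- x) ^ q = - (x ^ q)" for x :: "bit alg_closure"
    using add[of x "- x"] q2 by (simp add: power_0_left minus_unique)
  then have sub: "is_subring F"
    using add q2 by (auto simp: is_subring_def F_def power_mult_distrib power_0_left)
  \<comment> \<open>\<open>F\<close> is the root set of \<open>P\<close>. The derivative of
    \<open>P\<close> is \<open>- 1\<close>, so no root is multiple and the number of roots is the
    degree \<open>q\<close>.\<close>
  define P :: "bit alg_closure poly" where "P = Polynomial.monom 1 q - Polynomial.monom 1 1"
  have rootP: "poly P x = 0 \<longleftrightarrow> x \<in> F" for x by (simp add: P_def F_def poly_monom)
  have degP: "Polynomial.degree P = q"
    unfolding P_def using q2 by (subst diff_conv_add_uminus, subst degree_add_eq_left) (auto simp: degree_monom_eq)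
  then have P0: "P \<noteq> 0" using q2 by auto
  have "of_nat q = (0 :: bit alg_closure)" unfolding of_nat_eq_0_iff_char_dvd ch q_def using m by simp
  then have dP: "pderiv P = - 1" by (simp add: P_def pderiv_diff pderiv_monom)
  obtain A where A: "size A = Polynomial.degree P" "P = smult (Polynomial.lead_coeff P) (\<Prod>x\<in>#A. [:- x, 1:])"
    using alg_closed_imp_factorization[OF P0] by blast
  have lc: "Polynomial.lead_coeff P \<noteq> 0" using P0 by simp
  have rootA: "x \<in># A \<longleftrightarrow> poly P x = 0" for x
  proof -
    have "poly P x = Polynomial.lead_coeff P * (\<Prod>a\<in>#A. x - a)"
      by (subst A(2)) (simp add: poly_prod_mset image_mset.compositionality o_def)
    then show ?thesis using lc by (auto simp: prod_mset_zero_iff)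
  qed
  have count_le: "count A x \<le> 1" for x
  proof (rule ccontr)
    assume "\<not> count A x \<le> 1"
    then have "x \<in># A" "x \<in># A - {#x#}" by (auto simp flip: count_greater_zero_iff)
    then obtain B where B: "A = add_mset x (add_mset x B)" by (metis insert_DiffM)
    define Q where "Q = smult (Polynomial.lead_coeff P) (\<Prod>x\<in>#B. [:- x, 1:])"
    have "P = [:- x, 1:] * ([:- x, 1:] * Q)"
      by (subst A(2)) (simp add: B Q_def)
    then have "poly (pderiv P) x = 0" by (simp add: pderiv_mult del: mult_pCons_left)
    then show False using dP by simp
  qed
  have "A = mset_set (set_mset A)"
  proof (rule multiset_eqI)
    fix x
    show "count A x = count (mset_set (set_mset A)) x"
    proof (cases "x \<in># A")
      case True
      then have "count A x = 1" using count_le[of x] unfolding count_greater_zero_iff[symmetric] by linarith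
      then show ?thesis using True by simp
    qed (simp add: not_in_iff)
  qed
  then have "card (set_mset A) = size A" by (metis size_mset_set)
  moreover have "set_mset A = F" using rootA rootP by auto
  ultimately have "card F = 2 ^ m" "finite F" using A(1) degP by (auto simp: q_def)
  then show ?thesis using sub by blast
qed

section \<open>The extremal number\<close>

text \<open>\<open>m\<close> is the last exponent for which \<open>k * (2 ^ m) ^ l\<close> does not
  exceed \<open>n\<close>; raising it by one costs the factor \<open>2 ^ l\<close>. The third
  assumption says that \<open>m = 1\<close> is still admissible.\<close>

lemma power_of_two_scale:
  fixes k l n :: nat
  assumes "k \<ge> 1" "l \<ge> 1" "k * 2 ^ l \<le> n"
  obtains m :: nat where "m \<ge> 1" "k * (2 ^ m) ^ l \<le> n" "n < k * 2 ^ l * (2 ^ m) ^ l"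
proof -
  define P where "P = (\<lambda>m. n < k * (2 ^ m) ^ l)"
  have "n < 2 ^ n" by simp
  also have "(2::nat) ^ n \<le> (2 ^ n) ^ l" using assms(2) by (simp add: self_le_power)
  also have "\<dots> \<le> k * (2 ^ n) ^ l" using assms(1) by simp
  finally have "P n" by (simp add: P_def)
  then obtain m0 where m0: "\<forall>i<m0. \<not> P i" "P m0" using ex_least_nat_le[of P n] by blast
  have "(1::nat) \<le> 2 ^ l" by simp
  then have "k * 1 \<le> k * 2 ^ l" by (intro mult_left_mono) auto
  then have "k \<le> n" using assms(3) by linarith
  then have "\<not> P 0" "\<not> P 1" using assms(3) by (simp_all add: P_def not_less)
  then have "m0 \<noteq> 0" "m0 \<noteq> 1" using m0(2) by metis+
  then obtain m where m: "m0 = Suc m" "m \<ge> 1" by (cases m0) auto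
  have "k * (2 ^ m) ^ l \<le> n" using m0(1) m(1) by (auto simp: P_def not_less)
  moreover have "n < k * 2 ^ l * (2 ^ m) ^ l" using m0(2) m(1) by (simp add: P_def power_mult_distrib mult_ac)
  ultimately show ?thesis using that m by blast
qed

text \<open>With \<open>q = 2 ^ m\<close> the construction has \<open>k * q ^ l \<le> n\<close>
  vertices and at least \<open>(q ^ l) ^ (k - 1) * q\<close> edges, which is \<open>q ^ l\<close> to
  the power \<open>k - 1 + 1 / l\<close>; and \<open>q ^ l\<close> exceeds
  \<open>n / (k * 2 ^ l)\<close>.\<close>

lemma dense_suspended_cycle_free_complex:
  assumes k: "k \<ge> 2" and l: "l \<in> {3, 5}" and n: "k * 2 ^ l \<le> n"
  obtains K :: "nat hypergraph" where "abstract_simplicial_complex K" "card (verts K) = n"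
    "complex_free (down_closure (suspension k (cycle_graph (2 * l)))) K"
    "(1 / (real k * 2 ^ l)) powr (real k - 1 + 1 / l) * real n powr (real k - 1 + 1 / l) \<le> real (card (edges K))"
proof -
  define a where "a = real k - 1 + 1 / l"
  have l2: "l \<ge> 2" using l by auto
  obtain m where m: "m \<ge> 1" "k * (2 ^ m) ^ l \<le> n" "n < k * 2 ^ l * (2 ^ m) ^ l"
    using power_of_two_scale[of k l n] k l2 n by auto
  define q :: nat where "q = 2 ^ m"
  have q0: "q > 0" by (simp add: q_def)
  obtain F :: "bit alg_closure set" where F: "is_subring F" "finite F" "card F = q"
    using finite_subfield_exists[OF m(1)] unfolding q_def by blast
  interpret group "curve_group l F" by (rule group_curve_group[OF F(1)])
  let ?C = "carrier (curve_group l F)"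
  define S where "S = base_point ` F"
  have SC: "S \<subseteq> ?C"
    using F(1) l2 by (auto simp: S_def curve_group_simps base_point_def is_subring_def)
  have "inj (base_point :: bit alg_closure \<Rightarrow> _)" by (auto simp: inj_on_def base_point_def fun_eq_iff split: if_splits)
  then have cardS: "card S = q" unfolding S_def using F(3) by (simp add: card_image inj_on_subset)
  let ?H = "prod_edges S k"
  obtain K :: "nat hypergraph" where K: "abstract_simplicial_complex K" "card (verts K) = n"
    "complex_free (down_closure (suspension k (cycle_graph (2 * l)))) K" "card ?H \<le> card (edges K)"
  proof (rule ex_complex_lower[of ?H "{..<k} \<times> ?C" k n "2 * l"])
    show "\<not> contains_suspended_cycle ?H k (2 * l)"
      by (rule prod_edges_no_suspended_cycle[OF k l2])
         (use curve_group_no_closed_walk[OF F(1) l] in \<open>auto simp: S_def\<close>)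
    show "card ({..<k} \<times> ?C) \<le> n"
      using m(2) by (simp add: card_cartesian_product card_curve_group[OF F(2)] F(3) q_def)
  qed (use prod_edges_sub card_curve_group[OF F(2)] k l2 in auto)
  have "(q ^ l) ^ (k - 1) * q \<le> card (edges K)"
    using card_prod_edges[OF card_curve_group(1)[OF F(2)] SC, of k] K(4) k
    by (simp add: card_curve_group[OF F(2)] F(3) cardS)
  then have "real ((q ^ l) ^ (k - 1) * q) \<le> real (card (edges K))" by (simp only: of_nat_le_iff)
  moreover have "real ((q ^ l) ^ (k - 1) * q) = (real q ^ l) powr a"
  proof -
    have "(real q ^ l) powr a = (real q ^ l) powr real (k - 1) * (real q ^ l) powr (1 / l)"
      unfolding a_def using k by (simp add: of_nat_diff flip: powr_add)
    also have "(real q ^ l) powr (1 / l) = real q"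
      using q0 l2 by (simp add: powr_powr flip: powr_realpow)
    also have "(real q ^ l) powr real (k - 1) = (real q ^ l) ^ (k - 1)"
      using q0 by (intro powr_realpow) simp
    finally show ?thesis by simp
  qed
  moreover have "(1 / (real k * 2 ^ l)) powr a * real n powr a \<le> (real q ^ l) powr a"
  proof -
    have "real n \<le> real (k * 2 ^ l * q ^ l)" using m(3) unfolding q_def by (simp only: of_nat_le_iff)
    then have "real n \<le> (real k * 2 ^ l) * real q ^ l" by simp
    then have "1 / (real k * 2 ^ l) * real n \<le> real q ^ l"
      using k by (simp add: field_simps)
    moreover have "a \<ge> 0" using k by (simp add: a_def)
    ultimately have "(1 / (real k * 2 ^ l) * real n) powr a \<le> (real q ^ l) powr a"
      by (intro powr_mono2) auto
    then show ?thesis by (subst (asm) powr_mult) auto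
  qed
  ultimately have "(1 / (real k * 2 ^ l)) powr a * real n powr a \<le> real (card (edges K))" by linarith
  then show ?thesis using that[OF K(1-3)] unfolding a_def by blast
qed

theorem corollary11:
  fixes k l :: nat
  assumes "k \<ge> 2" and "l \<in> {3, 5}"
  shows "(\<lambda>n. real (ex_complex n (down_closure (suspension k (cycle_graph (2 * l))))))
           \<in> \<Theta>(\<lambda>n. real n powr (real k - 1 + 1 / real l))"
proof (rule bigthetaI)
  let ?F = "down_closure (suspension k (cycle_graph (2 * l)))"
  let ?a = "real k - 1 + 1 / real l"
  have l1: "l \<ge> 1" using assms(2) by auto
  let ?c = "(1 / (real k * 2 ^ l)) powr ?a"
  have "?c > 0" using assms(1) by simp
  moreover have "?c * norm (real n powr ?a) \<le> norm (real (ex_complex n ?F))" if n: "n \<ge> k * 2 ^ l" for n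
  proof -
    obtain K :: "nat hypergraph" where K: "abstract_simplicial_complex K" "card (verts K) = n" "complex_free ?F K"
        "?c * real n powr ?a \<le> real (card (edges K))"
      using dense_suspended_cycle_free_complex[OF assms n] by blast
    have "real (card (edges K)) \<le> real (ex_complex n ?F)" using ex_complex_ge[OF K(1-3)] by simp
    then show ?thesis using K(4) by simp
  qed
  ultimately show "(\<lambda>n. real (ex_complex n ?F)) \<in> \<Omega>(\<lambda>n. real n powr ?a)"
    by (intro landau_omega.bigI[of ?c] eventually_sequentiallyI[of "k * 2 ^ l"]) auto
  define C where "C = 2 + 196 * real l * 4 ^ l"
  have "C \<ge> 0" by (simp add: C_def)
  have "norm (real (ex_complex n ?F)) \<le> (2 ^ (k - 2) * C) * norm (real n powr ?a)" if n: "n \<ge> k * 2 ^ l" for n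
  proof -
    have n1: "n \<ge> 1"
    proof -
      have "0 < k * 2 ^ l" using assms(1) by simp
      then show ?thesis using n by linarith
    qed
    \<comment> \<open>Some free complex on \<open>n\<close> vertices is required for the maximum to
      be attained; the one from the lower bound serves.\<close>
    obtain K0 :: "nat hypergraph" where K0: "abstract_simplicial_complex K0" "card (verts K0) = n" "complex_free ?F K0"
      using dense_suspended_cycle_free_complex[OF assms n] by blast
    obtain K :: "nat hypergraph" where K: "abstract_simplicial_complex K" "card (verts K) = n" "complex_free ?F K"
        "card (edges K) = ex_complex n ?F"
      using ex_complex_witness[OF K0] by blast
    have "\<not> contains_suspended_cycle (edges K) k (2 * l)"
      using complex_free_iff[OF K(1)] K(3) l1 by simp
    from card_complex_upper[OF K(1,2) n1 this assms(1) l1]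
    have "real (ex_complex n ?F) \<le> (real n + 1) ^ (k - 2) * (C * real n powr (1 + 1 / l))"
      unfolding K(4) C_def by (simp add: add.commute)
    also have "\<dots> \<le> (2 * real n) ^ (k - 2) * (C * real n powr (1 + 1 / l))"
      using n1 \<open>C \<ge> 0\<close> by (intro mult_right_mono power_mono) auto
    also have "\<dots> = (2 ^ (k - 2) * C) * (real n ^ (k - 2) * real n powr (1 + 1 / l))"
      by (simp add: power_mult_distrib)
    also have "real n ^ (k - 2) * real n powr (1 + 1 / l) = real n powr (real (k - 2) + (1 + 1 / l))"
      using n1 by (simp add: powr_add powr_realpow)
    also have "real (k - 2) + (1 + 1 / l) = ?a" using assms(1) by (simp add: of_nat_diff)
    finally show ?thesis by simp
  qed
  then show "(\<lambda>n. real (ex_complex n ?F)) \<in> O(\<lambda>n. real n powr ?a)"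
    by (intro bigoI[of _ "2 ^ (k - 2) * C"] eventually_sequentiallyI[of "k * 2 ^ l"]) auto
qed

end
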